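(* Let $M$ be a compact oriented $3$-manifold (without boundary), so $n=3$, with a triangulation $\mathscr T$ and dual polyhedral decomposition $\mathscr T^\vee$. Let $\kappa_1\in C_1(\mathscr T)$ and $\kappa_2\in C_1(\mathscr T^\vee)$ be two rationally null-homologous oriented knots. The combinatorial Poincaré series $$\eta(z)=\sum_{c\in\mathcal G^\perp(\kappa_1,\kappa_2)}\varepsilon_c\,m_c\,z^{|c|}$$ converges whenever $|z|$ is small enough. Moreover, it extends to a rational function in $z$, regular at $z=1/(n+2)=1/5$, and $$\eta\left(\frac1{n+2}\right)=\mathrm{lk}(\kappa_1,\kappa_2).$$
   Context: Chains and orientations. All simplices of $\mathscr T$ are oriented; every $2$-simplex lies in the boundary of exactly two $3$-simplices. Boundary orientations use the convention "outward-pointing vector first" (combinatorially: the face omitting vertex number $k+1$ receives $(-1)^k$ times the restricted vertex ordering). $C_k(\mathscr T)$ is the space of simplicial $k$-chains with complex coefficients, with scalar product $\langle\cdot,\cdot\rangle$ for which the oriented $k$-simplices form an orthonormal basis; $\partial$ is the boundary. $\mathscr T^\vee$ is the dual cell decomposition: each $k$-simplex $\sigma$ has a dual $(n-k)$-cell (a union of simplices of the barycentric subdivision) meeting $\sigma$ once and no other $k$-simplex. The map $\star:C_k(\mathscr T)\to C_{n-k}(\mathscr T^\vee)$ sends $\sigma$ to its dual cell, oriented so that at the intersection the orientation of $\sigma$ followed by that of $\star\sigma$ is the orientation of $M$; similarly $\star:C_k(\mathscr T^\vee)\to C_{n-k}(\mathscr T)$, and $\star^2=(-1)^{k(n-k)}\mathrm{Id}$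 on $k$-chains (so $\star^2=\mathrm{Id}$ for $n=3$). Knots and linking number. A knot is any closed integral $1$-chain in $\mathscr T$ or $\mathscr T^\vee$. Rationally null-homologous means that there are positive integers $p_1,p_2$ and integral chains $\sigma_1\in C_2(\mathscr T)$, $\sigma_2\in C_2(\mathscr T^\vee)$ with $\partial\sigma_j=p_j\kappa_j$. The linking number is the algebraic intersection number of $\sigma_1$ with $\kappa_2$ divided by $p_1$; equivalently $\mathrm{lk}(\kappa_1,\kappa_2)=\frac1{p_2}\langle\kappa_1,\star\sigma_2\rangle\in\mathbb Q$. Orthogeodesics. An ordered pair of $2$-simplices is admissible if they share a common edge and do not both lie in the boundary of one and the same $3$-simplex; an admissible pair has compatible orientation if the two simplices induce opposite orientations on their common edge. A combinatorial geodesic path is a finite sequence $c=(\tau_1,\dots,\tau_k)$, $k\geqslant1$, of $2$-simplices with all consecutive pairs admissible; $|c|=k$ is its length, and $\varepsilon_c=(-1)^{n_c}$ its reversing index, where $n_c$ is the number of consecutive pairs $(\tau_i,\tau_{i+1})$, $1\leqslant i<k$, which are not compatibly oriented. $\mathcal G^\perp(\kappa_1,\kappa_2)$ is the set of orthogeodesic paths, i.e. combinatorial geodesic paths $c=(\tau_1,\dots,\tau_k)$ with $|\langle\partial\tau_1,\kappa_1\rangle|>0$ and $|\langle\tau_k,\star\kappa_2\rangle|>0$. The incidence number is $m_c=\langle\partial\tau_1,\kappa_1\rangle\,\langle\tau_k,\star\kappa_2\rangle$. *)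

theory Defs
  imports "HOL-Analysis.Analysis" "HOL-Combinatorics.Permutations"
begin

section \<open>Closed 3-manifolds and triangulations\<close>

(* Second countability is automatic for compact, locally Euclidean spaces. *)
definition closed_3_manifold :: "'m topology \<Rightarrow> bool" where
  "closed_3_manifold M \<longleftrightarrow>
     compact_space M \<and> Hausdorff_space M \<and>
     (\<forall>x\<in>topspace M. \<exists>U. \<exists>V :: (real^3) set.
        openin M U \<and> x \<in> U \<and> open V \<and> subtopology M U homeomorphic_space top_of_set V)"

definition triangulates :: "'a::euclidean_space set set \<Rightarrow> ('a \<Rightarrow> 'm) \<Rightarrow> 'm topology \<Rightarrow> bool" where
  "triangulates \<T> h M \<longleftrightarrow>
     simplicial_complex \<T> \<and> homeomorphic_map (top_of_set (\<Union>\<T>)) M h"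

definition simplices :: "'a::euclidean_space set set \<Rightarrow> nat \<Rightarrow> 'a set set" where
  "simplices \<T> k = {S \<in> \<T>. int k simplex S}"

definition vertices :: "'a::euclidean_space set \<Rightarrow> 'a set" where
  "vertices S = {v. v extreme_point_of S}"

section \<open>Oriented simplices and chains\<close>

(* The oriented simplex represented by the vertex ordering ys is this sign times the one
   represented by xs; the value is 0 if the two lists are not orderings of the same vertices. *)
definition orientation_sign :: "'b list \<Rightarrow> 'b list \<Rightarrow> int" where
  "orientation_sign xs ys =
     (if distinct xs \<and> mset xs = mset ys
      then sign (THE p. p permutes {..<length xs} \<and> permute_list p xs = ys) else 0)"

(* The orientation of a simplex S is represented by an ordering ori S of its vertices; only its
   class modulo even permutations matters below. *)
definition simplex_orientations :: "'a::euclidean_space set set \<Rightarrow> ('a set \<Rightarrow> 'a list) \<Rightarrow> bool" where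
  "simplex_orientations \<T> ori \<longleftrightarrow>
     (\<forall>S\<in>\<T>. distinct (ori S) \<and> set (ori S) = vertices S)"

(* The coefficient of the oriented simplex F in the boundary of the oriented simplex S. *)
definition incidence :: "('a set \<Rightarrow> 'a list) \<Rightarrow> 'a set \<Rightarrow> 'a set \<Rightarrow> int" where
  "incidence ori S F =
     (\<Sum>i<length (ori S).
        (-1) ^ i * orientation_sign (take i (ori S) @ drop (Suc i) (ori S)) (ori F))"

(* A chain is given by its coefficients with respect to the oriented simplices. *)
type_synonym 'a chain = "'a set \<Rightarrow> complex"

definition chains :: "'a::euclidean_space set set \<Rightarrow> nat \<Rightarrow> 'a chain set" where
  "chains \<T> k = {c. \<forall>S. S \<notin> simplices \<T> k \<longrightarrow> c S = 0}"

definition integral_chains :: "'a::euclidean_space set set \<Rightarrow> nat \<Rightarrow> 'a chain set" where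
  "integral_chains \<T> k = {c \<in> chains \<T> k. \<forall>S. c S \<in> \<int>}"

definition single :: "'a set \<Rightarrow> 'a chain" where
  "single S = (\<lambda>T. if T = S then 1 else 0)"

definition chain_inner :: "'a set set \<Rightarrow> 'a chain \<Rightarrow> 'a chain \<Rightarrow> complex" where
  "chain_inner \<T> c d = (\<Sum>S\<in>\<T>. c S * cnj (d S))"

(* A simplicial complex contains the empty set as its (-1)-simplex; it is left out here, so that
   the boundary is not augmented. *)
definition boundary ::
    "'a set set \<Rightarrow> ('a set \<Rightarrow> 'a list) \<Rightarrow> 'a chain \<Rightarrow> 'a chain" where
  "boundary \<T> ori c =
     (\<lambda>F. if F \<in> \<T> - {{}} then \<Sum>S\<in>\<T>. c S * of_int (incidence ori S F) else 0)"

(* An orientation of the triangulated manifold: signs turning the given orientations of the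
   3-simplices into positive ones, such that the sum of all positively oriented 3-simplices is a
   cycle, i.e. any two adjacent ones induce opposite orientations on their common face. *)
definition manifold_orientation ::
    "'a::euclidean_space set set \<Rightarrow> ('a set \<Rightarrow> 'a list) \<Rightarrow> ('a set \<Rightarrow> int) \<Rightarrow> bool" where
  "manifold_orientation \<T> ori \<mu> \<longleftrightarrow>
     (\<forall>S\<in>simplices \<T> 3. \<mu> S \<in> {1, -1}) \<and>
     boundary \<T> ori (\<lambda>S. if S \<in> simplices \<T> 3 then of_int (\<mu> S) else 0) = (\<lambda>F. 0)"

section \<open>The dual decomposition\<close>

(* The flag [S0, ..., Sj], S0 < ... < Sj, stands for the simplex of the barycentric subdivision
   spanned by the barycentres of S0, ..., Sj, oriented by this ordering of its vertices. *)
definition flags :: "'a set set \<Rightarrow> 'a set list set" where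
  "flags \<T> = {F. F \<noteq> [] \<and> set F \<subseteq> \<T> - {{}} \<and> sorted_wrt (\<subset>) F}"

type_synonym 'a sd_chain = "'a set list \<Rightarrow> complex"

definition sd_boundary :: "'a set set \<Rightarrow> 'a sd_chain \<Rightarrow> 'a sd_chain" where
  "sd_boundary \<T> c =
     (\<lambda>G. if G \<in> flags \<T>
          then \<Sum>F\<in>flags \<T>. c F * (\<Sum>i<length F. if take i F @ drop (Suc i) F = G then (-1) ^ i else 0)
          else 0)"

(* The vertices added at the successive steps of a flag whose dimensions increase by one. *)
definition added_vertices :: "'a::euclidean_space set list \<Rightarrow> 'a list" where
  "added_vertices F =
     map (\<lambda>j. the_elem (vertices (F ! Suc j) - vertices (F ! j))) [0..<length F - 1]"

(* The dual cell of a k-simplex S, as an oriented chain of the barycentric subdivision: it consists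
   of the flags S = S_k < S_(k+1) < ... < S_3 with dim S_j = j. If v_j is the vertex of S_j not in
   S_(j-1), then the vector from the barycentre of S_(j-1) to that of S_j is, modulo the affine
   span of S_(j-1), a positive multiple of the one to v_j. So the orientation of S followed by that
   of the flag is the orientation of the vertex ordering ori S @ [v_(k+1), ..., v_3], and the
   sign compares this with the orientation of the manifold. *)
definition dual_cell ::
    "'a::euclidean_space set set \<Rightarrow> ('a set \<Rightarrow> 'a list) \<Rightarrow> ('a set \<Rightarrow> int) \<Rightarrow> 'a set \<Rightarrow> 'a sd_chain" where
  "dual_cell \<T> ori \<mu> S =
     (\<lambda>F. if F \<in> flags \<T> \<and> hd F = S \<and> last F \<in> simplices \<T> 3 \<and> card (vertices S) + length F = 5
          then of_int (\<mu> (last F) * orientation_sign (ori S @ added_vertices F) (ori (last F)))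
          else 0)"

definition star ::
    "'a::euclidean_space set set \<Rightarrow> ('a set \<Rightarrow> 'a list) \<Rightarrow> ('a set \<Rightarrow> int) \<Rightarrow> 'a chain \<Rightarrow> 'a sd_chain" where
  "star \<T> ori \<mu> c = (\<lambda>F. \<Sum>S\<in>\<T>. c S * dual_cell \<T> ori \<mu> S F)"

(* Chains of the dual decomposition are combinations of dual cells inside the chains of the
   barycentric subdivision; their boundary is sd_boundary. *)
definition dual_chains ::
    "'a::euclidean_space set set \<Rightarrow> ('a set \<Rightarrow> 'a list) \<Rightarrow> ('a set \<Rightarrow> int) \<Rightarrow> nat \<Rightarrow> 'a sd_chain set" where
  "dual_chains \<T> ori \<mu> k = star \<T> ori \<mu> ` chains \<T> (3 - k)"

definition integral_dual_chains ::
    "'a::euclidean_space set set \<Rightarrow> ('a set \<Rightarrow> 'a list) \<Rightarrow> ('a set \<Rightarrow> int) \<Rightarrow> nat \<Rightarrow> 'a sd_chain set" where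
  "integral_dual_chains \<T> ori \<mu> k = star \<T> ori \<mu> ` integral_chains \<T> (3 - k)"

(* The star operator on dual k-chains. It sends a dual k-cell D to the simplex S meeting it,
   oriented so that D followed by S is the orientation of the manifold. Moving the k directions of
   D past the 3 - k directions of S gives the sign. *)
definition dual_star ::
    "'a::euclidean_space set set \<Rightarrow> ('a set \<Rightarrow> 'a list) \<Rightarrow> ('a set \<Rightarrow> int) \<Rightarrow> nat \<Rightarrow> 'a sd_chain \<Rightarrow> 'a chain" where
  "dual_star \<T> ori \<mu> k d =
     (\<lambda>S. (-1) ^ (k * (3 - k)) * inv_into (chains \<T> (3 - k)) (star \<T> ori \<mu>) d S)"

section \<open>Knots and linking numbers\<close>

definition knot ::
    "'a::euclidean_space set set \<Rightarrow> ('a set \<Rightarrow> 'a list) \<Rightarrow> 'a chain \<Rightarrow> bool" where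
  "knot \<T> ori \<kappa> \<longleftrightarrow> \<kappa> \<in> integral_chains \<T> 1 \<and> boundary \<T> ori \<kappa> = (\<lambda>S. 0)"

definition dual_knot ::
    "'a::euclidean_space set set \<Rightarrow> ('a set \<Rightarrow> 'a list) \<Rightarrow> ('a set \<Rightarrow> int) \<Rightarrow> 'a sd_chain \<Rightarrow> bool" where
  "dual_knot \<T> ori \<mu> \<kappa> \<longleftrightarrow>
     \<kappa> \<in> integral_dual_chains \<T> ori \<mu> 1 \<and> sd_boundary \<T> \<kappa> = (\<lambda>F. 0)"

definition rationally_null_homologous ::
    "'a::euclidean_space set set \<Rightarrow> ('a set \<Rightarrow> 'a list) \<Rightarrow> 'a chain \<Rightarrow> bool" where
  "rationally_null_homologous \<T> ori \<kappa> \<longleftrightarrow>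
     (\<exists>p::nat. p > 0 \<and>
        (\<exists>\<sigma>\<in>integral_chains \<T> 2. boundary \<T> ori \<sigma> = (\<lambda>S. of_nat p * \<kappa> S)))"

definition dual_rationally_null_homologous ::
    "'a::euclidean_space set set \<Rightarrow> ('a set \<Rightarrow> 'a list) \<Rightarrow> ('a set \<Rightarrow> int) \<Rightarrow> 'a sd_chain \<Rightarrow> bool" where
  "dual_rationally_null_homologous \<T> ori \<mu> \<kappa> \<longleftrightarrow>
     (\<exists>p::nat. p > 0 \<and>
        (\<exists>\<sigma>\<in>integral_dual_chains \<T> ori \<mu> 2. sd_boundary \<T> \<sigma> = (\<lambda>F. of_nat p * \<kappa> F)))"

(* The algebraic intersection number of a 2-chain with a dual 1-chain: a 2-simplex meets its own
   dual 1-cell once, with sign +1, and no other dual 1-cell. *)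
definition intersection_number ::
    "'a::euclidean_space set set \<Rightarrow> ('a set \<Rightarrow> 'a list) \<Rightarrow> ('a set \<Rightarrow> int) \<Rightarrow> 'a chain \<Rightarrow> 'a sd_chain \<Rightarrow> complex" where
  "intersection_number \<T> ori \<mu> \<sigma> d = chain_inner \<T> \<sigma> (dual_star \<T> ori \<mu> 1 d)"

(* Independent of the choice of p and \<sigma> if both knots are rationally null-homologous. *)
definition linking_number ::
    "'a::euclidean_space set set \<Rightarrow> ('a set \<Rightarrow> 'a list) \<Rightarrow> ('a set \<Rightarrow> int) \<Rightarrow> 'a chain \<Rightarrow> 'a sd_chain \<Rightarrow> rat" where
  "linking_number \<T> ori \<mu> \<kappa>1 \<kappa>2 =
     (THE q. \<exists>p::nat. p > 0 \<and>
        (\<exists>\<sigma>\<in>integral_chains \<T> 2.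
           boundary \<T> ori \<sigma> = (\<lambda>S. of_nat p * \<kappa>1 S) \<and>
           of_rat q = intersection_number \<T> ori \<mu> \<sigma> \<kappa>2 / of_nat p))"

section \<open>Orthogeodesics and the Poincare series\<close>

definition common_edge :: "'a::euclidean_space set set \<Rightarrow> 'a set \<Rightarrow> 'a set \<Rightarrow> 'a set \<Rightarrow> bool" where
  "common_edge \<T> S T E \<longleftrightarrow> E \<in> simplices \<T> 1 \<and> E face_of S \<and> E face_of T"

definition admissible :: "'a::euclidean_space set set \<Rightarrow> 'a set \<Rightarrow> 'a set \<Rightarrow> bool" where
  "admissible \<T> S T \<longleftrightarrow>
     S \<in> simplices \<T> 2 \<and> T \<in> simplices \<T> 2 \<and> (\<exists>E. common_edge \<T> S T E) \<and>
     \<not> (\<exists>R\<in>simplices \<T> 3. S face_of R \<and> T face_of R)"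

(* The common edge of an admissible pair is unique. *)
definition compatible ::
    "'a::euclidean_space set set \<Rightarrow> ('a set \<Rightarrow> 'a list) \<Rightarrow> 'a set \<Rightarrow> 'a set \<Rightarrow> bool" where
  "compatible \<T> ori S T \<longleftrightarrow>
     (\<exists>E. common_edge \<T> S T E \<and> incidence ori S E = - incidence ori T E)"

definition geodesic_path :: "'a::euclidean_space set set \<Rightarrow> 'a set list \<Rightarrow> bool" where
  "geodesic_path \<T> c \<longleftrightarrow>
     c \<noteq> [] \<and> set c \<subseteq> simplices \<T> 2 \<and> successively (admissible \<T>) c"

definition reversing_index ::
    "'a::euclidean_space set set \<Rightarrow> ('a set \<Rightarrow> 'a list) \<Rightarrow> 'a set list \<Rightarrow> complex" where
  "reversing_index \<T> ori c =
     (-1) ^ card {i. Suc i < length c \<and> \<not> compatible \<T> ori (c ! i) (c ! Suc i)}"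

definition incidence_number ::
    "'a::euclidean_space set set \<Rightarrow> ('a set \<Rightarrow> 'a list) \<Rightarrow> ('a set \<Rightarrow> int) \<Rightarrow>
     'a chain \<Rightarrow> 'a sd_chain \<Rightarrow> 'a set list \<Rightarrow> complex" where
  "incidence_number \<T> ori \<mu> \<kappa>1 \<kappa>2 c =
     chain_inner \<T> (boundary \<T> ori (single (hd c))) \<kappa>1 *
     chain_inner \<T> (single (last c)) (dual_star \<T> ori \<mu> 1 \<kappa>2)"

definition orthogeodesics ::
    "'a::euclidean_space set set \<Rightarrow> ('a set \<Rightarrow> 'a list) \<Rightarrow> ('a set \<Rightarrow> int) \<Rightarrow>
     'a chain \<Rightarrow> 'a sd_chain \<Rightarrow> 'a set list set" where
  "orthogeodesics \<T> ori \<mu> \<kappa>1 \<kappa>2 =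
     {c. geodesic_path \<T> c \<and>
         norm (chain_inner \<T> (boundary \<T> ori (single (hd c))) \<kappa>1) > 0 \<and>
         norm (chain_inner \<T> (single (last c)) (dual_star \<T> ori \<mu> 1 \<kappa>2)) > 0}"

definition poincare_term ::
    "'a::euclidean_space set set \<Rightarrow> ('a set \<Rightarrow> 'a list) \<Rightarrow> ('a set \<Rightarrow> int) \<Rightarrow>
     'a chain \<Rightarrow> 'a sd_chain \<Rightarrow> complex \<Rightarrow> 'a set list \<Rightarrow> complex" where
  "poincare_term \<T> ori \<mu> \<kappa>1 \<kappa>2 z c =
     reversing_index \<T> ori c * incidence_number \<T> ori \<mu> \<kappa>1 \<kappa>2 c * z ^ length c"

definition poincare_series ::
    "'a::euclidean_space set set \<Rightarrow> ('a set \<Rightarrow> 'a list) \<Rightarrow> ('a set \<Rightarrow> int) \<Rightarrow>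
     'a chain \<Rightarrow> 'a sd_chain \<Rightarrow> complex \<Rightarrow> complex" where
  "poincare_series \<T> ori \<mu> \<kappa>1 \<kappa>2 z =
     (\<Sum>\<^sub>\<infinity>c\<in>orthogeodesics \<T> ori \<mu> \<kappa>1 \<kappa>2. poincare_term \<T> ori \<mu> \<kappa>1 \<kappa>2 z c)"

end

theory Submission
  imports Defs
begin

text \<open>Let \<open>\<Delta> = \<partial>\<^sup>*\<partial> + \<partial>\<partial>\<^sup>*\<close> be the combinatorial Laplacian on 2-chains. Its diagonal entries are \<open>3 + 2 = 5\<close>,
  and \<open>A = 5 - \<Delta>\<close> has the entry \<open>1\<close> or \<open>-1\<close> at every admissible pair, according to compatibility, and
  \<open>0\<close> elsewhere: the contributions of two triangles in a common tetrahedron cancel because \<open>\<partial>\<partial> = 0\<close>.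
  Hence \<open>\<eta>(z) = z \<langle>\<partial>\<^sup>*\<kappa>\<^sub>1, (1 - zA)\<^sup>-\<^sup>1 v\<rangle>\<close> with \<open>v = \<star>\<kappa>\<^sub>2\<close>. At \<open>z = 1/5\<close> the operator \<open>1 - zA = \<Delta>/5\<close> may be
  singular, but \<open>\<partial>\<^sup>*\<kappa>\<^sub>1 = \<partial>\<^sup>*\<partial>\<sigma>\<close> (with \<open>\<partial>\<sigma> = \<kappa>\<^sub>1\<close>, rationally) is orthogonal to its kernel, so no pole
  arises. If \<open>\<Delta>x = \<partial>\<^sup>*\<partial>\<sigma>\<close> then \<open>\<partial>x = \<partial>\<sigma>\<close>, and \<open>v\<close> lies in the image of \<open>\<partial>\<^sup>*\<close> because \<open>\<kappa>\<^sub>2\<close> bounds a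
  dual chain; so the value is \<open>\<langle>x, v\<rangle> = \<langle>\<sigma>, v\<rangle>\<close>, the linking number.\<close>

section \<open>Orientation signs\<close>

text \<open>Entries of a distinct list determine their positions, so only one permutation of the
  index set realises a given rearrangement. This resolves the \<open>THE\<close> in
  \<open>orientation_sign\<close> once; afterwards it suffices to exhibit a permutation.\<close>

lemma orientation_sign_permute_list:
  assumes "distinct xs" "p permutes {..<length xs}"
  shows "orientation_sign xs (permute_list p xs) = sign p"
proof -
  have "(THE q. q permutes {..<length xs} \<and> permute_list q xs = permute_list p xs) = p"
  proof (rule the_equality)
    fix q assume q: "q permutes {..<length xs} \<and> permute_list q xs = permute_list p xs"
    show "q = p"
    proof
      fix i
      show "q i = p i"
      proof (cases "i < length xs")
        case True
        then have "xs ! q i = xs ! p i"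
          using q assms permute_list_nth by metis
        moreover have "q i < length xs" "p i < length xs"
          using True q assms permutes_in_image[of _ "{..<length xs}" i] by auto
        ultimately show ?thesis
          using assms(1) nth_eq_iff_index_eq by blast
      qed (use q assms in \<open>auto simp: permutes_def\<close>)
    qed
  qed (use assms in simp)
  then show ?thesis
    using assms by (simp add: orientation_sign_def)
qed

lemma orientation_sign_neq_mset: "mset xs \<noteq> mset ys \<Longrightarrow> orientation_sign xs ys = 0"
  by (simp add: orientation_sign_def)

lemma orientation_sign_refl: "distinct xs \<Longrightarrow> orientation_sign xs xs = 1"
  using orientation_sign_permute_list[of xs id] by (simp add: permutes_id)

text \<open>Signs multiply under composition of permutations. If \<open>zs\<close> is not a
  rearrangement of \<open>ys\<close>, both sides take the default value 0.\<close>

lemma orientation_sign_trans: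
  assumes "distinct xs" "mset xs = mset ys"
  shows "orientation_sign xs ys * orientation_sign ys zs = orientation_sign xs zs"
proof (cases "mset ys = mset zs")
  case True
  obtain p where p: "p permutes {..<length xs}" "permute_list p xs = ys"
    using mset_eq_permutation assms(2) by metis
  obtain q where q: "q permutes {..<length ys}" "permute_list q ys = zs"
    using mset_eq_permutation True by metis
  have len: "length ys = length xs" and dys: "distinct ys"
    using assms mset_eq_length mset_eq_imp_distinct_iff by metis+
  have zs: "zs = permute_list (p \<circ> q) xs"
    using p q len by (simp add: permute_list_compose)
  have "orientation_sign xs ys = sign p"
    using orientation_sign_permute_list[OF assms(1) p(1)] p(2) by simp
  moreover have "orientation_sign ys zs = sign q"
    using orientation_sign_permute_list[OF dys q(1)] q(2) by simp
  moreover have "orientation_sign xs zs = sign (p \<circ> q)"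
    unfolding zs using p q len assms(1)
    by (intro orientation_sign_permute_list permutes_compose) auto
  moreover have "permutation p" "permutation q"
    using p(1) q(1) by (auto intro: permutes_imp_permutation[OF finite_lessThan])
  ultimately show ?thesis
    by (simp add: sign_compose)
qed (use assms in \<open>simp add: orientation_sign_neq_mset\<close>)

lemma orientation_sign_values:
  assumes "distinct xs" "mset xs = mset ys"
  shows "orientation_sign xs ys = 1 \<or> orientation_sign xs ys = -1"
proof -
  obtain p where p: "p permutes {..<length xs}" "permute_list p xs = ys"
    using mset_eq_permutation assms(2) by metis
  then show ?thesis
    using orientation_sign_permute_list[OF assms(1) p(1)] by (auto simp: sign_def)
qed

lemma orientation_sign_commute:
  assumes "distinct xs"
  shows "orientation_sign xs ys = orientation_sign ys xs"
proof (cases "mset xs = mset ys")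
  case True
  have "orientation_sign xs ys * orientation_sign ys xs = 1"
    using assms True by (simp add: orientation_sign_trans orientation_sign_refl)
  then show ?thesis
    using orientation_sign_values[OF assms True] by auto
qed (simp add: orientation_sign_neq_mset)

text \<open>A permutation carrying \<open>xs\<close> to \<open>ys\<close> fixes the index
  \<open>length xs\<close>, so the same permutation carries \<open>xs @ [a]\<close> to
  \<open>ys @ [a]\<close>.\<close>

lemma orientation_sign_snoc:
  assumes "distinct xs" "a \<notin> set xs"
  shows "orientation_sign (xs @ [a]) (ys @ [a]) = orientation_sign xs ys"
proof (cases "mset xs = mset ys")
  case True
  obtain p where p: "p permutes {..<length xs}" "permute_list p xs = ys"
    using mset_eq_permutation True by metis
  have p': "p permutes {..<length (xs @ [a])}"
    using p(1) by (rule permutes_subset) auto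
  have "p (length xs) = length xs"
    using p(1) by (simp add: permutes_def)
  then have "permute_list p (xs @ [a]) = permute_list p xs @ [a]"
    using p(1) permutes_in_image[OF p(1)]
    by (auto simp: permute_list_def nth_append)
  then show ?thesis
    using orientation_sign_permute_list[of "xs @ [a]", OF _ p'] assms p
      orientation_sign_permute_list[of xs, OF _ p(1)] by simp
qed (simp add: orientation_sign_neq_mset)

lemma orientation_sign_swap:
  assumes "distinct (xs @ a # b # ys)"
  shows "orientation_sign (xs @ a # b # ys) (xs @ b # a # ys) = -1"
proof -
  let ?xs = "xs @ a # b # ys" and ?p = "Transposition.transpose (length xs) (Suc (length xs))"
  have p: "?p permutes {..<length ?xs}"
    by (intro permutes_swap_id) auto
  have "permute_list ?p ?xs = xs @ b # a # ys"
    by (rule nth_equalityI)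
      (auto simp: permute_list_nth[OF p] nth_append nth_Cons' Transposition.transpose_def)
  then show ?thesis
    using orientation_sign_permute_list[OF assms p] by (simp add: sign_swap_id)
qed

text \<open>Here \<open>a\<close> is exchanged with one entry of \<open>ys\<close> at a time, each
  exchange being a transposition; in the induction the prefix \<open>xs\<close> absorbs the entries
  already passed.\<close>

lemma orientation_sign_move_to_end:
  assumes "distinct (xs @ a # ys)"
  shows "orientation_sign (xs @ a # ys) (xs @ ys @ [a]) = (-1) ^ length ys"
  using assms
proof (induction ys arbitrary: xs)
  case Nil
  then show ?case by (simp add: orientation_sign_refl)
next
  case (Cons b ys)
  have "orientation_sign (xs @ a # b # ys) (xs @ b # a # ys)
      * orientation_sign (xs @ b # a # ys) (xs @ (b # ys) @ [a])
      = orientation_sign (xs @ a # b # ys) (xs @ (b # ys) @ [a])"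
    by (rule orientation_sign_trans) (use Cons.prems in auto)
  moreover have "orientation_sign ((xs @ [b]) @ a # ys) ((xs @ [b]) @ ys @ [a]) = (-1) ^ length ys"
    using Cons.prems by (intro Cons.IH) auto
  ultimately show ?case
    using orientation_sign_swap[OF Cons.prems] by simp
qed

section \<open>Sums over paths\<close>

fun path_weight :: "('x \<Rightarrow> 'x \<Rightarrow> complex) \<Rightarrow> 'x list \<Rightarrow> complex" where
  "path_weight A (x # y # c) = A x y * path_weight A (y # c)"
| "path_weight A c = 1"

text \<open>This is the entry at \<open>x\<close> of \<open>A^k v\<close>, with \<open>A\<close>
  restricted to \<open>X\<close>.\<close>

fun walk_sum :: "'x set \<Rightarrow> ('x \<Rightarrow> 'x \<Rightarrow> complex) \<Rightarrow> ('x \<Rightarrow> complex) \<Rightarrow> nat \<Rightarrow> 'x \<Rightarrow> complex" where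
  "walk_sum X A v 0 x = v x"
| "walk_sum X A v (Suc k) x = (\<Sum>x'\<in>X. A x x' * walk_sum X A v k x')"

lemma walk_sum_eq_sum_paths:
  "walk_sum X A v k x
     = (\<Sum>c | set c \<subseteq> X \<and> length c = k. path_weight A (x # c) * v (last (x # c)))"
proof (induction k arbitrary: x)
  case 0
  have "{c. set c \<subseteq> X \<and> length c = 0} = {[]}" by auto
  then show ?case by simp
next
  case (Suc k)
  let ?L = "{c. set c \<subseteq> X \<and> length c = k}"
  have "(\<Sum>c | set c \<subseteq> X \<and> length c = Suc k. path_weight A (x # c) * v (last (x # c)))
    = (\<Sum>(c, y)\<in>?L \<times> X. path_weight A (x # y # c) * v (last (x # y # c)))"
    unfolding lists_length_Suc_eq
    by (subst sum.reindex) (auto simp: inj_on_def case_prod_unfold)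
  also have "\<dots> = (\<Sum>y\<in>X. \<Sum>c\<in>?L. path_weight A (x # y # c) * v (last (x # y # c)))"
    by (subst sum.cartesian_product[symmetric]) (rule sum.swap)
  also have "\<dots> = (\<Sum>y\<in>X. A x y * walk_sum X A v k y)"
    unfolding Suc.IH sum_distrib_left by (simp add: mult.assoc)
  finally show ?case by simp
qed

text \<open>A path with \<open>Suc k\<close> vertices takes \<open>k\<close> steps, so the paths of
  this length contribute the matrix coefficient \<open>u^T A^k v\<close>.\<close>

lemma sum_paths:
  "(\<Sum>c | set c \<subseteq> X \<and> length c = Suc k. u (hd c) * (path_weight A c * v (last c)))
     = (\<Sum>x\<in>X. u x * walk_sum X A v k x)"
proof -
  let ?L = "{c. set c \<subseteq> X \<and> length c = k}"
  have "(\<Sum>c | set c \<subseteq> X \<and> length c = Suc k. u (hd c) * (path_weight A c * v (last c)))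
    = (\<Sum>(c, y)\<in>?L \<times> X. u y * (path_weight A (y # c) * v (last (y # c))))"
    unfolding lists_length_Suc_eq
    by (subst sum.reindex) (auto simp: inj_on_def case_prod_unfold)
  also have "\<dots> = (\<Sum>y\<in>X. \<Sum>c\<in>?L. u y * (path_weight A (y # c) * v (last (y # c))))"
    by (subst sum.cartesian_product[symmetric]) (rule sum.swap)
  finally show ?thesis
    unfolding walk_sum_eq_sum_paths sum_distrib_left .
qed

text \<open>There are \<open>card X ^ k\<close> walks with \<open>k\<close> steps from a given
  vertex, each of weight at most 1 in norm. The bound on \<open>norm z\<close> therefore allows
  comparison with a geometric series.\<close>

locale path_series =
  fixes X :: "'x set" and A :: "'x \<Rightarrow> 'x \<Rightarrow> complex" and u v :: "'x \<Rightarrow> complex" and z :: complex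
  assumes fin: "finite X"
    and A: "\<And>x x'. norm (A x x') \<le> 1"
    and z: "norm z * card X < 1"
begin

lemma norm_walk_sum_le:
  "x \<in> X \<Longrightarrow> norm (walk_sum X A v k x) \<le> real (card X) ^ k * (\<Sum>x\<in>X. norm (v x))"
proof (induction k arbitrary: x)
  case 0
  then show ?case
    using fin member_le_sum[of x X "\<lambda>x. norm (v x)"] by simp
next
  case (Suc k)
  have "norm (walk_sum X A v (Suc k) x) \<le> (\<Sum>x'\<in>X. norm (A x x' * walk_sum X A v k x'))"
    by (simp add: norm_sum)
  also have "\<dots> \<le> (\<Sum>x'\<in>X. real (card X) ^ k * (\<Sum>x\<in>X. norm (v x)))"
  proof (rule sum_mono)
    fix x' assume "x' \<in> X"
    have "norm (A x x' * walk_sum X A v k x') \<le> 1 * norm (walk_sum X A v k x')"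
      unfolding norm_mult using A by (intro mult_right_mono) auto
    then show "norm (A x x' * walk_sum X A v k x') \<le> real (card X) ^ k * (\<Sum>x\<in>X. norm (v x))"
      using Suc.IH[OF \<open>x' \<in> X\<close>] by simp
  qed
  finally show ?case by simp
qed

lemma summable_walk_sum: "x \<in> X \<Longrightarrow> summable (\<lambda>k. z ^ k * walk_sum X A v k x)"
proof (rule summable_comparison_test[OF exI[of _ 0]])
  assume x: "x \<in> X"
  show "\<forall>k\<ge>0. norm (z ^ k * walk_sum X A v k x) \<le> (norm z * card X) ^ k * (\<Sum>x\<in>X. norm (v x))"
  proof (intro allI impI)
    fix k
    have "norm (z ^ k * walk_sum X A v k x) \<le> norm z ^ k * (real (card X) ^ k * (\<Sum>x\<in>X. norm (v x)))"
      unfolding norm_mult norm_power using x by (intro mult_left_mono norm_walk_sum_le) auto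
    then show "norm (z ^ k * walk_sum X A v k x) \<le> (norm z * card X) ^ k * (\<Sum>x\<in>X. norm (v x))"
      by (simp add: power_mult_distrib mult.assoc)
  qed
  show "summable (\<lambda>k. (norm z * card X) ^ k * (\<Sum>x\<in>X. norm (v x)))"
    using z by (intro summable_mult2 summable_geometric) simp
qed

text \<open>The Neumann series for \<open>(1 - z A)^-1 v\<close>.\<close>

definition green :: "'x \<Rightarrow> complex" where
  "green x = (\<Sum>k. z ^ k * walk_sum X A v k x)"

text \<open>Multiplying the Neumann series by \<open>z A\<close> shifts its index by one, which
  loses only the term \<open>v x\<close> at \<open>k = 0\<close>.\<close>

lemma green_equation:
  assumes "x \<in> X"
  shows "green x - z * (\<Sum>x'\<in>X. A x x' * green x') = v x"
proof -
  have "(\<lambda>k. z * (\<Sum>x'\<in>X. A x x' * (z ^ k * walk_sum X A v k x'))) sums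
      (z * (\<Sum>x'\<in>X. A x x' * green x'))"
    unfolding green_def by (intro sums_mult sums_sum summable_sums summable_walk_sum)
  moreover have "z * (\<Sum>x'\<in>X. A x x' * (z ^ k * walk_sum X A v k x'))
      = z ^ Suc k * walk_sum X A v (Suc k) x" for k
    by (simp add: sum_distrib_left mult_ac)
  ultimately have "(\<lambda>k. z ^ Suc k * walk_sum X A v (Suc k) x) sums (z * (\<Sum>x'\<in>X. A x x' * green x'))"
    by simp
  then have "(\<lambda>k. z ^ k * walk_sum X A v k x) sums (z * (\<Sum>x'\<in>X. A x x' * green x') + v x)"
    by (subst (asm) sums_Suc_iff) simp
  then show ?thesis
    unfolding green_def by (simp add: sums_iff)
qed

text \<open>Paths are grouped by length. The class \<open>L k\<close> is finite and its norms are
  dominated by a geometric series, so the whole family is absolutely summable; its unordered sum may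
  then be computed length by length, where it becomes the Neumann series.\<close>

lemma path_series_has_sum:
  "((\<lambda>c. u (hd c) * (path_weight A c * v (last c)) * z ^ length c)
     has_sum z * (\<Sum>x\<in>X. u x * green x)) {c. c \<noteq> [] \<and> set c \<subseteq> X}"
proof -
  define f where "f c = u (hd c) * (path_weight A c * v (last c)) * z ^ length c" for c
  define L where "L k = {c. set c \<subseteq> X \<and> length c = Suc k}" for k
  have finL: "finite (L k)" and cardL: "card (L k) = card X ^ Suc k" for k
    unfolding L_def using fin by (auto simp: finite_lists_length_eq card_lists_length_eq)
  have pw: "norm (path_weight A c) \<le> 1" for c
  proof (induction c rule: induct_list012)
    case (3 x y c)
    have "norm (A x y) * norm (path_weight A (y # c)) \<le> 1"
      using A 3(2) by (intro mult_le_one) auto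
    then show ?case
      by (simp add: norm_mult)
  qed auto
  have f_sums: "(\<lambda>k. sum f (L k)) sums (z * (\<Sum>x\<in>X. u x * green x))"
  proof -
    have "(\<lambda>k. z * (\<Sum>x\<in>X. u x * (z ^ k * walk_sum X A v k x))) sums (z * (\<Sum>x\<in>X. u x * green x))"
      unfolding green_def by (intro sums_mult sums_sum summable_sums summable_walk_sum)
    moreover have "z * (\<Sum>x\<in>X. u x * (z ^ k * walk_sum X A v k x)) = sum f (L k)" for k
    proof -
      have "sum f (L k) = (\<Sum>c\<in>L k. u (hd c) * (path_weight A c * v (last c))) * z ^ Suc k"
        unfolding sum_distrib_right by (intro sum.cong) (auto simp: f_def L_def)
      then show ?thesis
        unfolding L_def sum_paths by (simp add: sum_distrib_left sum_distrib_right mult_ac)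
    qed
    ultimately show ?thesis by simp
  qed
  define C where "C = (\<Sum>x\<in>X. norm (u x)) * (\<Sum>x\<in>X. norm (v x))"
  have bound: "norm (f c) \<le> C * norm z ^ Suc k" if "c \<in> L k" for c k
  proof -
    have "c \<noteq> []" and c: "length c = Suc k" "set c \<subseteq> X"
      using that by (auto simp: L_def)
    then have "hd c \<in> X" "last c \<in> X"
      using hd_in_set last_in_set by blast+
    then have "norm (u (hd c)) \<le> (\<Sum>x\<in>X. norm (u x))" "norm (v (last c)) \<le> (\<Sum>x\<in>X. norm (v x))"
      using fin member_le_sum[of "hd c" X "\<lambda>x. norm (u x)"] member_le_sum[of "last c" X "\<lambda>x. norm (v x)"]
      by simp_all
    moreover have "norm (path_weight A c * v (last c)) \<le> 1 * norm (v (last c))"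
      unfolding norm_mult using pw by (intro mult_right_mono) auto
    ultimately have "norm (u (hd c)) * norm (path_weight A c * v (last c)) \<le> C"
      unfolding C_def by (intro mult_mono) (auto intro: sum_nonneg)
    then show ?thesis
      using c by (simp add: f_def norm_mult norm_power mult_right_mono)
  qed
  have "summable (\<lambda>k. \<Sum>c\<in>L k. norm (f c))"
  proof (rule summable_comparison_test[OF exI[of _ 0]])
    show "\<forall>k\<ge>0. norm (\<Sum>c\<in>L k. norm (f c)) \<le> C * (norm z * card X) ^ Suc k"
    proof (intro allI impI)
      fix k
      have "(\<Sum>c\<in>L k. norm (f c)) \<le> real (card (L k)) * (C * norm z ^ Suc k)"
        by (rule sum_bounded_above) (rule bound)
      then show "norm (\<Sum>c\<in>L k. norm (f c)) \<le> C * (norm z * card X) ^ Suc k"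
        unfolding cardL by (simp add: sum_nonneg power_mult_distrib mult_ac)
    qed
    show "summable (\<lambda>k. C * (norm z * card X) ^ Suc k)"
      using z by (intro summable_mult) (simp add: summable_Suc_iff summable_geometric del: power_Suc)
  qed
  then have "(\<lambda>k. \<Sum>c\<in>L k. norm (f c)) summable_on UNIV"
    by (intro norm_summable_imp_summable_on) (simp add: sum_nonneg)
  then have "(\<lambda>(k, c). norm (f c)) summable_on Sigma UNIV L"
    by (intro summable_on_SigmaI[where g = "\<lambda>k. \<Sum>c\<in>L k. norm (f c)"])
      (auto intro: has_sum_finite finL)
  then have "(\<lambda>(k, c). f c) summable_on Sigma UNIV L"
    using abs_summable_summable[of "\<lambda>(k, c). f c" "Sigma UNIV L"] by (simp add: case_prod_unfold)
  then obtain s where s: "((\<lambda>(k, c). f c) has_sum s) (Sigma UNIV L)"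
    by (auto simp: summable_on_def)
  then have "((\<lambda>k. sum f (L k)) has_sum s) UNIV"
    by (rule has_sum_SigmaD) (auto intro: has_sum_finite finL)
  then have "s = z * (\<Sum>x\<in>X. u x * green x)"
    using f_sums has_sum_imp_sums sums_unique2 by blast
  \<comment> \<open>The length of a nonempty path determines its class: \<open>c\<close> lies in
    \<open>L (length c - 1)\<close> only.\<close>
  moreover have "bij_betw snd (Sigma UNIV L) {c. c \<noteq> [] \<and> set c \<subseteq> X}"
  proof (intro bij_betw_imageI equalityI subsetI)
    fix c assume "c \<in> {c. c \<noteq> [] \<and> set c \<subseteq> X}"
    then have "(length c - 1, c) \<in> Sigma UNIV L"
      by (cases c) (auto simp: L_def)
    then show "c \<in> snd ` Sigma UNIV L"
      by force
  qed (auto simp: inj_on_def L_def)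
  ultimately have "(f has_sum z * (\<Sum>x\<in>X. u x * green x)) {c. c \<noteq> [] \<and> set c \<subseteq> X}"
    using s has_sum_reindex_bij_betw[of snd "Sigma UNIV L" _ f] by (simp add: case_prod_unfold)
  then show ?thesis
    by (simp add: f_def[abs_def])
qed

end

section \<open>Resolvents on a three-term complex\<close>

text \<open>Gaussian elimination without division. The multiplier \<open>q\<close> collects the
  pivots; since the matrix is the identity at 0, and stays so after each elimination step, every
  pivot has value 1 there.\<close>

lemma poly_linear_system_solvable:
  fixes M :: "'x \<Rightarrow> 'x \<Rightarrow> complex poly" and w :: "'x \<Rightarrow> complex poly"
  assumes "finite X"
    and "\<And>x x'. x \<in> X \<Longrightarrow> x' \<in> X \<Longrightarrow> poly (M x x') 0 = (if x = x' then 1 else 0)"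
  shows "\<exists>q Q. poly q 0 = 1 \<and> (\<forall>x\<in>X. (\<Sum>x'\<in>X. M x x' * Q x') = q * w x)"
  using assms
proof (induction X arbitrary: M w)
  case empty
  show ?case by (intro exI[of _ 1]) auto
next
  case (insert a X)
  define M' where "M' x x' = M a a * M x x' - M x a * M a x'" for x x'
  define w' where "w' x = M a a * w x - M x a * w a" for x
  have "\<exists>q Q. poly q 0 = 1 \<and> (\<forall>x\<in>X. (\<Sum>x'\<in>X. M' x x' * Q x') = q * w' x)"
    by (rule insert.IH) (use insert.hyps insert.prems in \<open>auto simp: M'_def\<close>)
  then obtain q Q where q: "poly q 0 = 1"
    and Q: "\<And>x. x \<in> X \<Longrightarrow> (\<Sum>x'\<in>X. M' x x' * Q x') = q * w' x"
    by auto
  \<comment> \<open>Back substitution. The reduced solution is scaled by the pivot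
    \<open>M a a\<close>, so that the coordinate at \<open>a\<close> is obtained without dividing by
    the pivot.\<close>
  define Q' where "Q' x = (if x = a then q * w a - (\<Sum>x'\<in>X. M a x' * Q x') else M a a * Q x)" for x
  have sumQ': "(\<Sum>x'\<in>insert a X. M x x' * Q' x')
      = M x a * (q * w a - (\<Sum>x'\<in>X. M a x' * Q x')) + M a a * (\<Sum>x'\<in>X. M x x' * Q x')" for x
  proof -
    have "(\<Sum>x'\<in>X. M x x' * Q' x') = (\<Sum>x'\<in>X. M a a * (M x x' * Q x'))"
      using insert.hyps by (intro sum.cong) (auto simp: Q'_def)
    then show ?thesis
      using insert.hyps by (simp add: Q'_def sum_distrib_left)
  qed
  have "(\<Sum>x'\<in>insert a X. M x x' * Q' x') = (q * M a a) * w x" if "x \<in> insert a X" for x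
  proof (cases "x = a")
    case True
    then show ?thesis unfolding sumQ' by (simp add: algebra_simps)
  next
    case False
    with that have "(\<Sum>x'\<in>X. M' x x' * Q x') = q * w' x" using Q by simp
    moreover have "(\<Sum>x'\<in>X. M' x x' * Q x')
       = M a a * (\<Sum>x'\<in>X. M x x' * Q x') - M x a * (\<Sum>x'\<in>X. M a x' * Q x')"
      by (simp add: M'_def sum_distrib_left sum_subtractf algebra_simps)
    ultimately show ?thesis
      unfolding sumQ' w'_def by algebra
  qed
  moreover have "poly (q * M a a) 0 = 1"
    using q insert.prems by simp
  ultimately show ?case by blast
qed

lemma poly_eq_by_eval:
  fixes p q :: "'b::{idom, ring_char_0} poly"
  assumes "\<And>z. poly p z = poly q z"
  shows "p = q"
  using assms by (metis poly_eq_poly_eq_iff ext)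

section \<open>Adjoints and the Laplacian of a three-term complex\<close>

lemma sum_mult_cnj_eq_0D:
  assumes "finite A" "(\<Sum>x\<in>A. f x * cnj (f x)) = 0" "a \<in> A"
  shows "f a = 0"
proof -
  have "complex_of_real (\<Sum>x\<in>A. (norm (f x))\<^sup>2) = 0"
    using assms(2) by (simp only: of_real_sum complex_norm_square)
  then have "(\<Sum>x\<in>A. (norm (f x))\<^sup>2) = 0"
    using of_real_eq_0_iff by blast
  then show ?thesis
    using assms by (subst (asm) sum_nonneg_eq_0_iff) auto
qed

text \<open>A model of three consecutive chain groups, spanned by \<open>Z\<close>, \<open>X\<close>
  and \<open>Y\<close>, with \<open>e\<close> and \<open>d\<close> the matrices of the boundary
  maps; \<open>exact\<close> says only that their composite vanishes. As the entries are integers,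
  transposes are Hermitian adjoints.\<close>

locale three_term_complex =
  fixes X :: "'x set" and Y :: "'y set" and Z :: "'z set"
    and d :: "'x \<Rightarrow> 'y \<Rightarrow> int" and e :: "'z \<Rightarrow> 'x \<Rightarrow> int"
  assumes fin: "finite X" "finite Y" "finite Z"
    and exact: "\<And>z y. z \<in> Z \<Longrightarrow> y \<in> Y \<Longrightarrow> (\<Sum>x\<in>X. e z x * d x y) = 0"
begin

definition bd :: "('x \<Rightarrow> complex) \<Rightarrow> 'y \<Rightarrow> complex" where
  "bd f y = (\<Sum>x\<in>X. of_int (d x y) * f x)"

definition cobd :: "('y \<Rightarrow> complex) \<Rightarrow> 'x \<Rightarrow> complex" where
  "cobd g x = (\<Sum>y\<in>Y. of_int (d x y) * g y)"

text \<open>The part of the Laplacian coming from \<open>Z\<close>: the boundary from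
  \<open>Z\<close> to \<open>X\<close> composed with its adjoint.\<close>

definition upper :: "('x \<Rightarrow> complex) \<Rightarrow> 'x \<Rightarrow> complex" where
  "upper f x = (\<Sum>z\<in>Z. of_int (e z x) * (\<Sum>x'\<in>X. of_int (e z x') * f x'))"

text \<open>The pairing is bilinear, without conjugation, because the series pairs vectors in this
  way. Positivity arguments insert conjugates by hand, through \<open>cnj_bd\<close>.\<close>

lemma bd_cobd_adjoint: "(\<Sum>y\<in>Y. bd f y * g y) = (\<Sum>x\<in>X. f x * cobd g x)"
  unfolding bd_def cobd_def sum_distrib_left sum_distrib_right
  by (subst sum.swap) (simp add: algebra_simps)

lemma cnj_bd: "cnj (bd f y) = bd (\<lambda>x. cnj (f x)) y"
  by (simp add: bd_def)

text \<open>Pairing \<open>cobd (bd f) = 0\<close> with the conjugate of \<open>f\<close> gives that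
  the squared norm of \<open>bd f\<close> is 0.\<close>

lemma cobd_bd_eq_0D:
  assumes "\<And>x. x \<in> X \<Longrightarrow> cobd (bd f) x = 0" "y \<in> Y"
  shows "bd f y = 0"
proof (rule sum_mult_cnj_eq_0D[OF fin(2) _ assms(2)])
  have "(\<Sum>y\<in>Y. bd f y * cnj (bd f y)) = cnj (\<Sum>y\<in>Y. bd (\<lambda>x. cnj (f x)) y * bd f y)"
    by (simp add: cnj_bd)
  also have "\<dots> = 0"
    unfolding bd_cobd_adjoint using assms(1) by simp
  finally show "(\<Sum>y\<in>Y. bd f y * cnj (bd f y)) = 0" .
qed

lemma bd_cobd_eq_0D:
  assumes "\<And>y. y \<in> Y \<Longrightarrow> bd (cobd g) y = 0" "x \<in> X"
  shows "cobd g x = 0"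
proof (rule sum_mult_cnj_eq_0D[OF fin(1) _ assms(2)])
  have "(\<Sum>x\<in>X. cnj (cobd g x) * cobd g x) = (\<Sum>y\<in>Y. bd (\<lambda>x. cnj (cobd g x)) y * g y)"
    using bd_cobd_adjoint by metis
  moreover have "bd (\<lambda>x. cnj (cobd g x)) y = 0" if "y \<in> Y" for y
    using assms(1)[OF that] cnj_bd[of "cobd g" y] by simp
  ultimately show "(\<Sum>x\<in>X. cobd g x * cnj (cobd g x)) = 0"
    by (simp add: mult.commute)
qed

lemma bd_upper: "y \<in> Y \<Longrightarrow> bd (upper f) y = 0"
proof -
  assume y: "y \<in> Y"
  define S where "S z = (\<Sum>x'\<in>X. of_int (e z x') * f x')" for z
  have "bd (upper f) y = (\<Sum>z\<in>Z. of_int (\<Sum>x\<in>X. e z x * d x y) * S z)"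
    unfolding bd_def upper_def S_def[symmetric] of_int_sum sum_distrib_right sum_distrib_left
    by (subst sum.swap) (simp add: mult_ac)
  also have "\<dots> = 0"
    using y by (simp add: exact del: of_int_sum)
  finally show ?thesis .
qed

lemma upper_cobd: "upper (cobd g) x = 0"
proof -
  have "(\<Sum>x'\<in>X. of_int (e z x') * cobd g x')
      = (\<Sum>y\<in>Y. of_int (\<Sum>x\<in>X. e z x * d x y) * g y)" for z
    unfolding cobd_def sum_distrib_left of_int_sum sum_distrib_right
    by (subst sum.swap) (simp add: mult_ac)
  then show ?thesis
    by (simp add: upper_def exact del: of_int_sum)
qed

text \<open>Applying \<open>bd\<close> removes the \<open>upper\<close> part, leaving
  \<open>bd (cobd (bd f)) = 0\<close>. Two uses of positivity then strip off the outer
  \<open>bd\<close> and the \<open>cobd\<close>.\<close>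

lemma laplacian_eq_0D:
  assumes "\<And>x. x \<in> X \<Longrightarrow> cobd (bd f) x + upper f x = 0" "y \<in> Y"
  shows "bd f y = 0"
proof -
  have "cobd (bd f) x = 0" if "x \<in> X" for x
  proof (rule bd_cobd_eq_0D[OF _ that])
    fix y assume y: "y \<in> Y"
    have "bd (cobd (bd f)) y + bd (upper f) y = bd (\<lambda>x. cobd (bd f) x + upper f x) y"
      by (simp add: bd_def sum.distrib algebra_simps)
    also have "\<dots> = 0"
      using assms(1) by (simp add: bd_def)
    finally show "bd (cobd (bd f)) y = 0"
      using bd_upper[OF y] by simp
  qed
  then show ?thesis
    using cobd_bd_eq_0D assms(2) by blast
qed

end

text \<open>Entrywise, \<open>A\<close> is \<open>t\<close> minus the Laplacian. Thus
  \<open>1 - z A\<close> at \<open>z = 1 / t\<close> is the Laplacian divided by \<open>t\<close>,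
  which is singular as soon as there are harmonic vectors.\<close>

locale path_operator = three_term_complex +
  fixes A :: "'a \<Rightarrow> 'a \<Rightarrow> complex" and t :: complex
  assumes t: "t \<noteq> 0"
    and laplacian: "\<And>x x'. x \<in> X \<Longrightarrow> x' \<in> X \<Longrightarrow>
      A x x' = (if x = x' then t else 0) - of_int (\<Sum>y\<in>Y. d x y * d x' y) - of_int (\<Sum>z\<in>Z. e z x * e z x')"
begin

lemma sum_A:
  assumes "x \<in> X"
  shows "(\<Sum>x'\<in>X. A x x' * f x') = t * f x - cobd (bd f) x - upper f x"
proof -
  have "cobd (bd f) x = (\<Sum>x'\<in>X. of_int (\<Sum>y\<in>Y. d x y * d x' y) * f x')"
    unfolding cobd_def bd_def sum_distrib_left of_int_sum sum_distrib_right
    by (subst sum.swap) (simp add: mult_ac)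
  moreover have "upper f x = (\<Sum>x'\<in>X. of_int (\<Sum>z\<in>Z. e z x * e z x') * f x')"
    unfolding upper_def sum_distrib_left of_int_sum sum_distrib_right
    by (subst sum.swap) (simp add: mult_ac)
  moreover have "(\<Sum>x'\<in>X. (if x = x' then t else 0) * f x') = t * f x"
    using assms fin(1) by (simp add: if_distrib[of "\<lambda>c. c * _"] cong: if_cong)
  ultimately show ?thesis
    using assms by (simp add: laplacian left_diff_distrib sum_subtractf)
qed

lemma A_sym: "x \<in> X \<Longrightarrow> x' \<in> X \<Longrightarrow> A x x' = A x' x"
  by (simp add: laplacian mult.commute)

text \<open>Solutions that are orthogonal to all cycles; this condition is what allows a zero of
  \<open>q\<close> at \<open>1 / t\<close> to be cancelled.\<close>

definition resolvent :: "('a \<Rightarrow> complex) \<Rightarrow> complex poly \<Rightarrow> ('a \<Rightarrow> complex poly) \<Rightarrow> bool" where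
  "resolvent u q P \<longleftrightarrow> poly q 0 \<noteq> 0 \<and>
     (\<forall>z. \<forall>x\<in>X. poly (P x) z - z * (\<Sum>x'\<in>X. A x x' * poly (P x') z) = poly q z * u x) \<and>
     (\<forall>f. (\<forall>y\<in>Y. bd f y = 0) \<longrightarrow> (\<forall>z. (\<Sum>x\<in>X. f x * poly (P x) z) = 0))"

text \<open>The system is first solved with right-hand side \<open>s\<close> instead of
  \<open>cobd (bd s)\<close>. Since \<open>cobd\<close> after \<open>bd\<close> commutes with
  \<open>A\<close>, applying it to that solution \<open>Q\<close> gives the required
  \<open>P\<close>; being in the image of \<open>cobd\<close>, \<open>P\<close> is orthogonal to all
  cycles.\<close>

lemma resolvent_exists: "\<exists>q P. resolvent (cobd (bd s)) q P"
proof -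
  define M where "M x x' = (if x = x' then 1 else 0) - [:0, A x x':]" for x x'
  have "\<exists>q Q. poly q 0 = 1 \<and> (\<forall>x\<in>X. (\<Sum>x'\<in>X. M x x' * Q x') = q * [:s x:])"
    by (rule poly_linear_system_solvable[OF fin(1)]) (auto simp: M_def)
  then obtain q Q where q: "poly q 0 = 1"
    and Q: "\<And>x. x \<in> X \<Longrightarrow> (\<Sum>x'\<in>X. M x x' * Q x') = q * [:s x:]"
    by auto
  define Qz where "Qz z x = poly (Q x) z" for z x
  have Qz: "Qz z x - z * (\<Sum>x'\<in>X. A x x' * Qz z x') = poly q z * s x" if x: "x \<in> X" for x z
  proof -
    have "poly q z * s x = poly (\<Sum>x'\<in>X. M x x' * Q x') z"
      using Q[OF x] by simp
    also have "\<dots> = (\<Sum>x'\<in>X. (if x = x' then Qz z x' else 0) - z * (A x x' * Qz z x'))"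
      unfolding poly_sum by (intro sum.cong) (auto simp: M_def Qz_def algebra_simps)
    also have "\<dots> = Qz z x - z * (\<Sum>x'\<in>X. A x x' * Qz z x')"
      using x fin(1) by (simp add: sum_subtractf sum_distrib_left)
    finally show ?thesis by simp
  qed
  define P where "P x = (\<Sum>y\<in>Y. smult (of_int (d x y)) (\<Sum>x'\<in>X. smult (of_int (d x' y)) (Q x')))" for x
  have P: "poly (P x) z = cobd (bd (Qz z)) x" for x z
    by (simp add: P_def cobd_def bd_def Qz_def poly_sum)
  have "poly (P x) z - z * (\<Sum>x'\<in>X. A x x' * poly (P x') z) = poly q z * cobd (bd s) x"
    if x: "x \<in> X" for x z
  proof -
    have Qz': "Qz z x' = poly q z * s x' + z * (t * Qz z x' - cobd (bd (Qz z)) x' - upper (Qz z) x')"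
      if "x' \<in> X" for x'
      using Qz[OF that, of z] by (simp add: sum_A[OF that] algebra_simps)
    have bdQ: "bd (Qz z) y = poly q z * bd s y + z * (t * bd (Qz z) y - bd (cobd (bd (Qz z))) y)"
      if y: "y \<in> Y" for y
    proof -
      have "bd (Qz z) y = bd (\<lambda>x'. poly q z * s x' + z * (t * Qz z x' - cobd (bd (Qz z)) x' - upper (Qz z) x')) y"
        unfolding bd_def[of _ y] using Qz' by (intro sum.cong) auto
      also have "\<dots> = poly q z * bd s y + z * (t * bd (Qz z) y - bd (cobd (bd (Qz z))) y - bd (upper (Qz z)) y)"
        by (simp add: bd_def[of _ y] sum.distrib sum_subtractf sum_distrib_left algebra_simps)
      finally show ?thesis using bd_upper[OF y] by simp
    qed
    have "cobd (bd (Qz z)) x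
        = cobd (\<lambda>y. poly q z * bd s y + z * (t * bd (Qz z) y - bd (cobd (bd (Qz z))) y)) x"
      unfolding cobd_def[of _ x] using bdQ by (intro sum.cong) auto
    also have "\<dots> = poly q z * cobd (bd s) x
        + z * (t * cobd (bd (Qz z)) x - cobd (bd (cobd (bd (Qz z)))) x)"
      by (simp add: cobd_def[of _ x] sum.distrib sum_subtractf sum_distrib_left algebra_simps)
    finally show ?thesis
      unfolding P sum_A[OF x] upper_cobd by (simp add: algebra_simps)
  qed
  moreover have "(\<Sum>x\<in>X. f x * poly (P x) z) = 0" if "\<forall>y\<in>Y. bd f y = 0" for f z
    unfolding P bd_cobd_adjoint[symmetric] using that by simp
  ultimately show ?thesis
    unfolding resolvent_def using q by (intro exI[of _ q] exI[of _ P]) auto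
qed

text \<open>If \<open>q\<close> vanishes at \<open>1 / t\<close>, the value \<open>f\<close> of
  \<open>P\<close> there is harmonic, hence a cycle, and so is its conjugate. As \<open>P\<close> is
  orthogonal to cycles, \<open>f\<close> has norm 0. So \<open>q\<close> and all \<open>P x\<close>
  share the linear factor \<open>?r\<close>, which can be divided out.\<close>

lemma resolvent_cancel:
  assumes "resolvent u q P" "poly q (1 / t) = 0"
  obtains q' P' where "resolvent u q' P'" "degree q' < degree q"
proof -
  let ?r = "[:- (1 / t), 1:]"
  define f where "f x = poly (P x) (1 / t)" for x
  have "cobd (bd f) x + upper f x = 0" if x: "x \<in> X" for x
  proof -
    have "poly (P x) (1 / t) - 1 / t * (\<Sum>x'\<in>X. A x x' * poly (P x') (1 / t)) = poly q (1 / t) * u x"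
      using assms(1) x unfolding resolvent_def by blast
    then have "f x - 1 / t * (\<Sum>x'\<in>X. A x x' * f x') = 0"
      using assms(2) by (simp add: f_def)
    then show ?thesis
      unfolding sum_A[OF x] using t by (simp add: field_simps)
  qed
  then have "\<forall>y\<in>Y. bd (\<lambda>x. cnj (f x)) y = 0"
    using laplacian_eq_0D cnj_bd[of f] by (metis complex_cnj_zero)
  then have "(\<Sum>x\<in>X. cnj (f x) * f x) = 0"
    using assms(1) by (simp add: resolvent_def f_def)
  then have "f x = 0" if "x \<in> X" for x
    using sum_mult_cnj_eq_0D[OF fin(1) _ that, of f] by (simp add: mult.commute)
  then have "\<forall>x\<in>X. \<exists>p. P x = ?r * p"
    using poly_eq_0_iff_dvd by (metis dvd_def f_def)
  then obtain P' where P': "\<And>x. x \<in> X \<Longrightarrow> P x = ?r * P' x"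
    by metis
  obtain q' where q': "q = ?r * q'"
    using assms(2) poly_eq_0_iff_dvd by (metis dvd_def)
  have P'z: "poly (P x) z = (z - 1 / t) * poly (P' x) z" if "x \<in> X" for x z
    unfolding P'[OF that] by (simp add: algebra_simps)
  have q'z: "poly q z = (z - 1 / t) * poly q' z" for z
    by (simp add: q' algebra_simps)
  have q0: "poly q' 0 \<noteq> 0"
    using assms(1) by (auto simp: resolvent_def q'z)
  then have "q' \<noteq> 0" by auto
  then have "degree q = Suc (degree q')"
    unfolding q' by (subst degree_mult_eq) auto
  moreover have "resolvent u q' P'"
    unfolding resolvent_def
  proof (intro conjI allI ballI impI)
    fix z x assume x: "x \<in> X"
    \<comment> \<open>The defect of the new equation as a polynomial. Its product with
      \<open>?r\<close> vanishes identically, so it is 0 itself; this gives the equation at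
      \<open>1 / t\<close> too, where dividing values would be impossible.\<close>
    define P'' where "P'' = P' x - [:0, 1:] * (\<Sum>x'\<in>X. smult (A x x') (P' x')) - smult (u x) q'"
    have "?r * P'' = 0"
    proof (rule poly_eq_by_eval)
      fix z
      define S where "S = (\<Sum>x'\<in>X. A x x' * poly (P' x') z)"
      have "poly (P x) z - z * (\<Sum>x'\<in>X. A x x' * poly (P x') z) = poly q z * u x"
        using assms(1) x by (simp add: resolvent_def)
      moreover have "(\<Sum>x'\<in>X. A x x' * poly (P x') z) = (z - 1 / t) * S"
        unfolding sum_distrib_left S_def by (intro sum.cong) (auto simp: P'z)
      ultimately have "(z - 1 / t) * poly (P' x) z - z * ((z - 1 / t) * S) = (z - 1 / t) * poly q' z * u x"
        using x by (simp add: P'z q'z)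
      moreover have "poly P'' z = poly (P' x) z - z * S - u x * poly q' z"
        by (simp add: P''_def poly_sum S_def)
      moreover have "poly ?r z = z - 1 / t"
        by simp
      ultimately show "poly (?r * P'') z = poly 0 z"
        unfolding poly_mult poly_0 by algebra
    qed
    then have "P'' = 0"
      unfolding mult_eq_0_iff by simp
    then have "poly P'' z = 0" by simp
    then show "poly (P' x) z - z * (\<Sum>x'\<in>X. A x x' * poly (P' x') z) = poly q' z * u x"
      by (simp add: P''_def poly_sum algebra_simps)
  next
    fix f z assume f: "\<forall>y\<in>Y. bd f y = 0"
    define P'' where "P'' = (\<Sum>x\<in>X. smult (f x) (P' x))"
    have "?r * P'' = 0"
    proof (rule poly_eq_by_eval)
      fix z
      have "(\<Sum>x\<in>X. f x * poly (P x) z) = 0"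
        using assms(1) f by (simp add: resolvent_def)
      moreover have "(\<Sum>x\<in>X. f x * poly (P x) z) = (z - 1 / t) * (\<Sum>x\<in>X. f x * poly (P' x) z)"
        unfolding sum_distrib_left by (intro sum.cong) (auto simp: P'z)
      ultimately show "poly (?r * P'') z = poly 0 z"
        by (simp add: P''_def poly_sum algebra_simps)
    qed
    then have "P'' = 0"
      unfolding mult_eq_0_iff by simp
    then have "poly P'' z = 0" by simp
    then show "(\<Sum>x\<in>X. f x * poly (P' x) z) = 0"
      by (simp add: P''_def poly_sum)
  qed (use q0 in auto)
  ultimately show ?thesis
    using that by simp
qed

text \<open>Each cancellation lowers \<open>degree q\<close>, so the zero at \<open>1 / t\<close>
  disappears after finitely many.\<close>

lemma regular_resolvent_exists: "\<exists>q P. resolvent (cobd (bd s)) q P \<and> poly q (1 / t) \<noteq> 0"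
proof -
  have "\<exists>q P. resolvent u q P \<and> poly q (1 / t) \<noteq> 0" if "resolvent u q P" for u q P
    using that
  proof (induction "degree q" arbitrary: q P rule: less_induct)
    case less
    then show ?case
      using resolvent_cancel by metis
  qed
  then show ?thesis
    using resolvent_exists by blast
qed

text \<open>As \<open>A\<close> is symmetric, \<open>1 - z A\<close> can be moved from
  \<open>P\<close> to \<open>G\<close>: \<open>q\<close> times the pairing of
  \<open>cobd (bd s)\<close> with \<open>G\<close> equals the pairing of \<open>P\<close> with
  \<open>v\<close>, a polynomial in \<open>z\<close>. So the regularity of the resolvent for
  \<open>cobd (bd s)\<close> suffices, and \<open>G\<close> may be any solution for
  \<open>v\<close>.\<close>

lemma resolvent_pairing:
  assumes v: "\<And>x. x \<in> X \<Longrightarrow> v x = cobd w x"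
  shows "\<exists>p q. poly q 0 \<noteq> 0 \<and> poly q (1 / t) \<noteq> 0 \<and>
    poly p (1 / t) / poly q (1 / t) = (\<Sum>x\<in>X. s x * v x) \<and>
    (\<forall>z G. (\<forall>x\<in>X. G x - z * (\<Sum>x'\<in>X. A x x' * G x') = v x) \<longrightarrow>
       poly q z * (z * (\<Sum>x\<in>X. cobd (bd s) x * G x)) = poly p z)"
proof -
  let ?u = "cobd (bd s)"
  obtain q P where r: "resolvent ?u q P" and q: "poly q (1 / t) \<noteq> 0"
    using regular_resolvent_exists by blast
  have eq: "poly (P x) z - z * (\<Sum>x'\<in>X. A x x' * poly (P x') z) = poly q z * ?u x" if "x \<in> X" for x z
    using r that by (simp add: resolvent_def)
  define p where "p = [:0, 1:] * (\<Sum>x\<in>X. smult (v x) (P x))"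
  have "poly q z * (z * (\<Sum>x\<in>X. ?u x * G x)) = poly p z"
    if G: "\<And>x. x \<in> X \<Longrightarrow> G x - z * (\<Sum>x'\<in>X. A x x' * G x') = v x" for z G
  proof -
    have "poly q z * (\<Sum>x\<in>X. ?u x * G x)
        = (\<Sum>x\<in>X. (poly (P x) z - z * (\<Sum>x'\<in>X. A x x' * poly (P x') z)) * G x)"
      unfolding sum_distrib_left[of "poly q z"] by (intro sum.cong) (simp_all add: eq)
    also have "\<dots> = (\<Sum>x\<in>X. poly (P x) z * G x) - z * (\<Sum>x\<in>X. \<Sum>x'\<in>X. A x x' * poly (P x') z * G x)"
      by (simp add: left_diff_distrib sum_subtractf sum_distrib_left sum_distrib_right mult.assoc)
    also have "(\<Sum>x\<in>X. \<Sum>x'\<in>X. A x x' * poly (P x') z * G x)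
        = (\<Sum>x\<in>X. \<Sum>x'\<in>X. poly (P x) z * (A x x' * G x'))"
      by (subst sum.swap) (auto intro!: sum.cong simp: A_sym mult_ac)
    also have "(\<Sum>x\<in>X. poly (P x) z * G x) - z * \<dots>
        = (\<Sum>x\<in>X. poly (P x) z * (G x - z * (\<Sum>x'\<in>X. A x x' * G x')))"
      by (simp add: right_diff_distrib sum_subtractf sum_distrib_left mult_ac)
    also have "\<dots> = (\<Sum>x\<in>X. poly (P x) z * v x)"
      using G by simp
    finally have "poly q z * (\<Sum>x\<in>X. ?u x * G x) = (\<Sum>x\<in>X. poly (P x) z * v x)" .
    then show ?thesis
      by (simp add: p_def poly_sum mult_ac)
  qed
  moreover have "poly p (1 / t) / poly q (1 / t) = (\<Sum>x\<in>X. s x * v x)"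
  proof -
    \<comment> \<open>At \<open>z = 1 / t\<close> the equation times \<open>t\<close> says that the
      Laplacian of \<open>P\<close> is \<open>c\<close> times \<open>cobd (bd s)\<close>. Hence
      \<open>P - c s\<close> turns out to be a cycle, and it pairs to 0 with
      \<open>v = cobd w\<close>. So \<open>P\<close> may be replaced by \<open>c s\<close> in the
      pairing with \<open>v\<close>.\<close>
    define c where "c = t * poly q (1 / t)"
    define f where "f x = poly (P x) (1 / t) - c * s x" for x
    have bdf: "bd f y = bd (\<lambda>x. poly (P x) (1 / t)) y - c * bd s y" for y
      by (simp add: bd_def f_def right_diff_distrib sum_subtractf sum_distrib_left mult_ac)
    have "cobd (bd f) x = - upper (\<lambda>x. poly (P x) (1 / t)) x" if x: "x \<in> X" for x
    proof -
      have "cobd (bd f) x = cobd (bd (\<lambda>x. poly (P x) (1 / t))) x - c * ?u x"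
        by (simp add: cobd_def[of _ x] bdf right_diff_distrib sum_subtractf sum_distrib_left mult_ac)
      moreover have "cobd (bd (\<lambda>x. poly (P x) (1 / t))) x + upper (\<lambda>x. poly (P x) (1 / t)) x = c * ?u x"
        using eq[OF x, of "1 / t"] t unfolding sum_A[OF x] by (simp add: c_def field_simps)
      ultimately show ?thesis by algebra
    qed
    then have "bd (cobd (bd f)) y = - bd (upper (\<lambda>x. poly (P x) (1 / t))) y" for y
      by (simp add: bd_def[of _ y] sum_negf)
    then have "bd (cobd (bd f)) y = 0" if "y \<in> Y" for y
      using bd_upper[OF that] by simp
    then have "cobd (bd f) x = 0" if "x \<in> X" for x
      using bd_cobd_eq_0D that by blast
    then have "bd f y = 0" if "y \<in> Y" for y
      using cobd_bd_eq_0D that by blast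
    then have "(\<Sum>x\<in>X. f x * v x) = 0"
      using bd_cobd_adjoint[of f w] v by simp
    then have "(\<Sum>x\<in>X. poly (P x) (1 / t) * v x) = c * (\<Sum>x\<in>X. s x * v x)"
      by (simp add: f_def left_diff_distrib sum_subtractf sum_distrib_left mult.assoc)
    then show ?thesis
      using t q by (simp add: p_def poly_sum c_def mult_ac)
  qed
  ultimately show ?thesis
    using r q by (intro exI[of _ p] exI[of _ q]) (auto simp: resolvent_def)
qed

end

section \<open>Incidence numbers and the Laplacian\<close>

lemma vertices_convex_hull:
  "\<not> affine_dependent C \<Longrightarrow> vertices (convex hull C) = C"
  by (simp add: vertices_def extreme_point_of_convex_hull_affine_independent)

section \<open>Simplices as vertex sets, and their incidence numbers\<close>

locale oriented_complex =
  fixes \<T> :: "'a::euclidean_space set set" and ori :: "'a set \<Rightarrow> 'a list"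
  assumes complex: "simplicial_complex \<T>" and orientations: "simplex_orientations \<T> ori"
begin

lemma finite_complex: "finite \<T>"
  using complex by (simp add: simplicial_complex_def)

lemma finite_simplices: "finite (simplices \<T> k)"
  using finite_complex by (simp add: simplices_def)

lemma simplices_in_complex: "S \<in> simplices \<T> k \<Longrightarrow> S \<in> \<T>"
  by (simp add: simplices_def)

lemma simplex_vertices:
  assumes "S \<in> \<T>"
  shows "\<not> affine_dependent (vertices S)" "convex hull (vertices S) = S" "finite (vertices S)"
proof -
  obtain n where "n simplex S"
    using assms complex by (auto simp: simplicial_complex_def)
  then obtain C where "\<not> affine_dependent C" "S = convex hull C"
    by (auto simp: simplex_def)
  then show "\<not> affine_dependent (vertices S)" "convex hull (vertices S) = S"
    by (simp_all add: vertices_convex_hull)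
  then show "finite (vertices S)"
    using aff_independent_finite by blast
qed

lemma in_simplices_iff: "S \<in> simplices \<T> k \<longleftrightarrow> S \<in> \<T> \<and> card (vertices S) = Suc k"
proof -
  have "int k simplex S \<longleftrightarrow> card (vertices S) = Suc k" if S: "S \<in> \<T>"
  proof
    assume "int k simplex S"
    then show "card (vertices S) = Suc k"
      by (auto simp: simplex_def vertices_convex_hull)
  next
    assume "card (vertices S) = Suc k"
    then show "int k simplex S"
      using simplex_vertices[OF S] by (auto simp: simplex_def intro!: exI[of _ "vertices S"])
  qed
  then show ?thesis
    by (auto simp: simplices_def)
qed

lemma vertices_inject:
  "S \<in> \<T> \<Longrightarrow> F \<in> \<T> \<Longrightarrow> vertices S = vertices F \<longleftrightarrow> S = F"
  using simplex_vertices(2) by metis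

lemma subset_vertices_face:
  assumes "S \<in> \<T>" "W \<subseteq> vertices S"
  obtains F where "F \<in> \<T>" "F face_of S" "vertices F = W"
proof
  have indep: "\<not> affine_dependent W"
    using assms simplex_vertices(1) affine_independent_subset by blast
  show "convex hull W face_of S"
    using assms face_of_convex_hull_affine_independent[of "vertices S"] simplex_vertices[of S] by auto
  then show "convex hull W \<in> \<T>"
    using assms complex by (auto simp: simplicial_complex_def)
  show "vertices (convex hull W) = W"
    using indep by (rule vertices_convex_hull)
qed

lemma face_iff_vertices_subset:
  assumes "S \<in> \<T>" "F \<in> \<T>"
  shows "F face_of S \<longleftrightarrow> vertices F \<subseteq> vertices S"
proof
  assume "F face_of S"
  then obtain c where "c \<subseteq> vertices S" "F = convex hull c"
    using assms face_of_convex_hull_affine_independent[of "vertices S"] simplex_vertices[of S] by auto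
  then show "vertices F \<subseteq> vertices S"
    using assms simplex_vertices(1) affine_independent_subset vertices_convex_hull by metis
next
  assume "vertices F \<subseteq> vertices S"
  then show "F face_of S"
    using assms face_of_convex_hull_affine_independent[of "vertices S"] simplex_vertices(1,2) by metis
qed

lemma ori:
  assumes "S \<in> \<T>"
  shows "distinct (ori S)" "set (ori S) = vertices S" "length (ori S) = card (vertices S)"
  using assms orientations distinct_card[of "ori S"] by (auto simp: simplex_orientations_def)

lemma mset_ori_eqI:
  assumes "S \<in> \<T>" "distinct xs" "set xs = vertices S"
  shows "mset xs = mset (ori S)"
  using assms ori(1,2)[OF assms(1)] set_eq_iff_mset_eq_distinct by blast

text \<open>Only deleting \<open>v\<close> leaves an ordering of \<open>F\<close>, so one summand
  survives. Moving \<open>v\<close> from position \<open>i\<close> to the end costs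
  \<open>(-1) ^ length bs\<close>, and \<open>i + length bs\<close> is the number of vertices of
  \<open>F\<close>, so the position of \<open>v\<close> drops out.\<close>

lemma incidence_facet:
  assumes S: "S \<in> \<T>" and F: "F \<in> \<T>" and v: "v \<notin> vertices F" and SF: "vertices S = insert v (vertices F)"
  shows "incidence ori S F = (-1) ^ card (vertices F) * orientation_sign (ori F @ [v]) (ori S)"
proof -
  have "v \<in> set (ori S)"
    using SF ori(2)[OF S] by simp
  then obtain as bs where ab: "ori S = as @ v # bs"
    using split_list by metis
  have dist: "distinct (as @ v # bs)"
    using ori(1)[OF S] ab by simp
  have oF: "set (ori F) = set (as @ bs)"
    using ori(2)[OF S] ori(2)[OF F] ab dist SF v by auto
  define i where "i = length as"
  let ?t = "\<lambda>j. (-1) ^ j * orientation_sign (take j (ori S) @ drop (Suc j) (ori S)) (ori F)"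
  have zero: "?t j = 0" if "j < length (ori S)" "j \<noteq> i" for j
  proof -
    have "v \<in> set (take j (ori S) @ drop (Suc j) (ori S))"
    proof (cases "j < i")
      case True
      then have "drop (Suc j) (ori S) = drop (Suc j) as @ v # bs"
        by (simp add: ab i_def)
      then show ?thesis by simp
    next
      case False
      then have "take j (ori S) = as @ v # take (j - Suc i) bs"
        using that by (simp add: ab i_def take_Cons')
      then show ?thesis by simp
    qed
    then have "mset (take j (ori S) @ drop (Suc j) (ori S)) \<noteq> mset (ori F)"
      using v ori(2)[OF F] mset_eq_setD by blast
    then show ?thesis by (simp add: orientation_sign_neq_mset)
  qed
  have "incidence ori S F = (\<Sum>j\<in>{i}. ?t j)"
    unfolding incidence_def
    by (rule sum.mono_neutral_right) (use zero in \<open>auto simp: i_def ab\<close>)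
  also have "\<dots> = (-1) ^ i * orientation_sign (as @ bs) (ori F)"
    by (simp add: i_def ab)
  also have "orientation_sign (as @ bs) (ori F) = orientation_sign ((as @ bs) @ [v]) (ori F @ [v])"
    using dist by (intro orientation_sign_snoc[symmetric]) auto
  also have "\<dots> = (-1) ^ length bs * orientation_sign (ori S) (ori F @ [v])"
  proof -
    have "orientation_sign (ori S) (as @ bs @ [v]) * orientation_sign (as @ bs @ [v]) (ori F @ [v])
       = orientation_sign (ori S) (ori F @ [v])"
      by (rule orientation_sign_trans) (use dist ab in auto)
    moreover have "orientation_sign (ori S) (as @ bs @ [v]) = (-1) ^ length bs"
      unfolding ab by (rule orientation_sign_move_to_end[OF dist])
    ultimately show ?thesis
      by (metis append_assoc left_minus_one_mult_self)
  qed
  also have "(-1) ^ i * \<dots> = (-1) ^ (i + length bs) * orientation_sign (ori S) (ori F @ [v])"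
    by (simp add: power_add)
  also have "i + length bs = card (vertices F)"
    using ori(3)[OF S] SF v simplex_vertices(3)[OF F] by (simp add: ab i_def)
  also have "orientation_sign (ori S) (ori F @ [v]) = orientation_sign (ori F @ [v]) (ori S)"
    by (rule orientation_sign_commute[OF ori(1)[OF S]])
  finally show ?thesis .
qed

lemma incidence_nonzeroE:
  assumes "S \<in> \<T>" "F \<in> \<T>" "incidence ori S F \<noteq> 0"
  obtains v where "v \<notin> vertices F" "vertices S = insert v (vertices F)"
proof -
  obtain i where i: "i < length (ori S)"
    and "orientation_sign (take i (ori S) @ drop (Suc i) (ori S)) (ori F) \<noteq> 0"
    using assms(3) unfolding incidence_def
    by (elim sum.not_neutral_contains_not_neutral) auto
  then have "mset (take i (ori S) @ drop (Suc i) (ori S)) = mset (ori F)"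
    using orientation_sign_neq_mset by blast
  then have set: "set (take i (ori S) @ drop (Suc i) (ori S)) = vertices F"
    using mset_eq_setD ori(2)[OF assms(2)] by metis
  have "ori S = take i (ori S) @ ori S ! i # drop (Suc i) (ori S)"
    using i by (rule id_take_nth_drop)
  then have "distinct (take i (ori S) @ ori S ! i # drop (Suc i) (ori S))"
    "vertices S = set (take i (ori S) @ ori S ! i # drop (Suc i) (ori S))"
    using ori(1,2)[OF assms(1)] by simp_all
  then show ?thesis
    using set by (intro that[of "ori S ! i"]) auto
qed

lemma facet_vertex:
  assumes "S \<in> simplices \<T> (Suc k)" "F \<in> simplices \<T> k" "vertices F \<subseteq> vertices S"
  obtains v where "v \<notin> vertices F" "vertices S = insert v (vertices F)"
proof -
  have c: "card (vertices S) = Suc (Suc k)" "card (vertices F) = Suc k"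
    and fin: "finite (vertices S)" "finite (vertices F)"
    using assms simplex_vertices(3) by (auto simp: in_simplices_iff)
  then have "card (vertices S - vertices F) = 1"
    using assms(3) by (simp add: card_Diff_subset)
  then obtain v where "vertices S - vertices F = {v}"
    using card_1_singletonE by blast
  then show ?thesis
    using assms(3) by (intro that[of v]) auto
qed

lemma incidence_values:
  assumes "S \<in> simplices \<T> (Suc k)" "F \<in> simplices \<T> k"
  shows "if vertices F \<subseteq> vertices S then incidence ori S F = 1 \<or> incidence ori S F = -1
    else incidence ori S F = 0"
proof (cases "vertices F \<subseteq> vertices S")
  case True
  obtain v where v: "v \<notin> vertices F" "vertices S = insert v (vertices F)"
    using facet_vertex[OF assms True] .
  have ST: "S \<in> \<T>" "F \<in> \<T>"
    using assms by (auto simp: in_simplices_iff)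
  have d: "distinct (ori F @ [v])"
    using ori[OF ST(2)] v by simp
  moreover have "mset (ori F @ [v]) = mset (ori S)"
    using d ori[OF ST(2)] v by (intro mset_ori_eqI[OF ST(1)]) auto
  ultimately have "orientation_sign (ori F @ [v]) (ori S) = 1 \<or> orientation_sign (ori F @ [v]) (ori S) = -1"
    by (rule orientation_sign_values)
  then show ?thesis
    using True incidence_facet[OF ST v] minus_one_power_iff[of "card (vertices F)", where 'a = int] by auto
next
  case False
  then show ?thesis
    using assms incidence_nonzeroE[of S F] by (auto simp: in_simplices_iff)
qed

lemma incidence_nonzero_subset:
  "S \<in> simplices \<T> (Suc k) \<Longrightarrow> F \<in> simplices \<T> k \<Longrightarrow> incidence ori S F \<noteq> 0 \<longleftrightarrow> vertices F \<subseteq> vertices S"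
  using incidence_values[of S k F] by (auto split: if_splits)

lemma incidence_square:
  "S \<in> simplices \<T> (Suc k) \<Longrightarrow> F \<in> simplices \<T> k \<Longrightarrow>
    incidence ori S F * incidence ori S F = (if vertices F \<subseteq> vertices S then 1 else 0)"
  using incidence_values[of S k F] by (auto split: if_splits)

text \<open>Each route from \<open>R\<close> down to \<open>E\<close> gives minus the sign of
  \<open>ori E\<close> followed by the two remaining vertices, the one lying in the intermediate
  face first. The minus sign comes from \<open>F\<close> and \<open>F'\<close> having one vertex
  more than \<open>E\<close>. The two routes list \<open>a\<close> and \<open>b\<close> in opposite
  orders, so they cancel.\<close>

lemma incidence_square_zero:
  assumes "R \<in> \<T>" "F \<in> \<T>" "F' \<in> \<T>" "E \<in> \<T>"
    and ab: "a \<noteq> b" "a \<notin> vertices E" "b \<notin> vertices E"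
    and F: "vertices F = insert a (vertices E)" and F': "vertices F' = insert b (vertices E)"
    and R: "vertices R = insert a (insert b (vertices E))"
  shows "incidence ori R F * incidence ori F E + incidence ori R F' * incidence ori F' E = 0"
proof -
  have through: "incidence ori R G * incidence ori G E = - orientation_sign (ori E @ [c, c']) (ori R)"
    if G: "G \<in> \<T>" "vertices G = insert c (vertices E)" and c: "c \<noteq> c'" "c \<notin> vertices E" "c' \<notin> vertices E"
      and R: "vertices R = insert c (insert c' (vertices E))" for G c c'
  proof -
    have c': "c' \<notin> vertices G" "vertices R = insert c' (vertices G)"
      using G c R by auto
    have 1: "incidence ori R G = (-1) ^ card (vertices G) * orientation_sign (ori G @ [c']) (ori R)"
      using incidence_facet[OF assms(1) G(1) c'] .
    have "incidence ori G E = (-1) ^ card (vertices E) * orientation_sign (ori E @ [c]) (ori G)"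
      using incidence_facet[OF G(1) assms(4) c(2) G(2)] .
    also have "orientation_sign (ori E @ [c]) (ori G) = orientation_sign ((ori E @ [c]) @ [c']) (ori G @ [c'])"
      using c ori[OF assms(4)] by (intro orientation_sign_snoc[symmetric]) auto
    finally have 2: "incidence ori G E
      = (-1) ^ card (vertices E) * orientation_sign (ori E @ [c, c']) (ori G @ [c'])"
      by simp
    have "mset (ori E @ [c]) = mset (ori G)"
      using c G ori[OF assms(4)] by (intro mset_ori_eqI) auto
    then have "orientation_sign (ori E @ [c, c']) (ori G @ [c']) * orientation_sign (ori G @ [c']) (ori R)
        = orientation_sign (ori E @ [c, c']) (ori R)"
      using c ori[OF assms(4)] by (intro orientation_sign_trans) auto
    moreover have "card (vertices G) = Suc (card (vertices E))"
      using G c simplex_vertices(3)[OF assms(4)] by simp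
    ultimately show ?thesis
      unfolding 1 2 by (simp add: mult_ac flip: mult.assoc power_add)
  qed
  have "orientation_sign (ori E @ [a, b]) (ori E @ [b, a]) * orientation_sign (ori E @ [b, a]) (ori R)
    = orientation_sign (ori E @ [a, b]) (ori R)"
    using ab ori[OF assms(4)] by (intro orientation_sign_trans) auto
  moreover have "orientation_sign (ori E @ [a, b]) (ori E @ [b, a]) = -1"
    using ab ori[OF assms(4)] by (intro orientation_sign_swap) auto
  ultimately show ?thesis
    using through[of F a b] through[of F' b a] assms by auto
qed

text \<open>This is \<open>\<partial>\<partial> = 0\<close>. If some term is nonzero,
  \<open>R\<close> is \<open>E\<close> with two vertices added; adding either one first gives the
  only two intermediate faces that contribute.\<close>

lemma incidence_exact:
  assumes R: "R \<in> simplices \<T> (Suc (Suc k))" and E: "E \<in> simplices \<T> k"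
  shows "(\<Sum>F\<in>simplices \<T> (Suc k). incidence ori R F * incidence ori F E) = 0"
proof (rule ccontr)
  assume nonzero: "\<not> ?thesis"
  then obtain F where F: "F \<in> simplices \<T> (Suc k)" and nz: "incidence ori R F * incidence ori F E \<noteq> 0"
    by (elim sum.not_neutral_contains_not_neutral) auto
  note T = simplices_in_complex[OF R] simplices_in_complex[OF E] simplices_in_complex[OF F]
  obtain b where b: "b \<notin> vertices F" "vertices R = insert b (vertices F)"
    using incidence_nonzeroE[OF T(1,3)] nz by auto
  obtain a where a: "a \<notin> vertices E" "vertices F = insert a (vertices E)"
    using incidence_nonzeroE[OF T(3,2)] nz by auto
  have "insert b (vertices E) \<subseteq> vertices R"
    using a b by auto
  then obtain F' where F': "F' \<in> \<T>" "vertices F' = insert b (vertices E)"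
    by (rule subset_vertices_face[OF T(1)])
  have "card (vertices F') = Suc (Suc k)"
    using F' a b E simplex_vertices(3)[OF T(2)] by (auto simp: in_simplices_iff)
  then have F'_in: "F' \<in> simplices \<T> (Suc k)"
    using F' by (simp add: in_simplices_iff)
  have ne: "F \<noteq> F'"
    using F' b by auto
  have "(\<Sum>F\<in>simplices \<T> (Suc k). incidence ori R F * incidence ori F E)
    = (\<Sum>F\<in>{F, F'}. incidence ori R F * incidence ori F E)"
  proof (rule sum.mono_neutral_right)
    show "\<forall>G\<in>simplices \<T> (Suc k) - {F, F'}. incidence ori R G * incidence ori G E = 0"
    proof (rule ballI, rule ccontr)
      fix G assume G: "G \<in> simplices \<T> (Suc k) - {F, F'}"
        and nz: "incidence ori R G * incidence ori G E \<noteq> 0"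
      have GT: "G \<in> \<T>"
        using G simplices_in_complex by blast
      have "vertices G \<subseteq> vertices R"
        using incidence_nonzeroE[OF T(1) GT] nz by (metis mult_eq_0_iff subset_insertI)
      moreover obtain c where "c \<notin> vertices E" "vertices G = insert c (vertices E)"
        using incidence_nonzeroE[OF GT T(2)] nz by auto
      ultimately have "vertices G = vertices F \<or> vertices G = vertices F'"
        using a b F' by auto
      then show False
        using vertices_inject GT T(3) F'(1) G by auto
    qed
  qed (use F F'_in finite_simplices in auto)
  also have "\<dots> = incidence ori R F * incidence ori F E + incidence ori R F' * incidence ori F' E"
    using ne by simp
  also have "\<dots> = 0"
    using T F' a b by (intro incidence_square_zero[of R F F' E a b]) auto
  finally show False
    using nonzero by simp
qed

end

section \<open>The signed matrix of admissible pairs of triangles\<close>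

definition transition :: "'a::euclidean_space set set \<Rightarrow> ('a set \<Rightarrow> 'a list) \<Rightarrow> 'a set \<Rightarrow> 'a set \<Rightarrow> complex" where
  "transition \<T> ori S T =
     (if admissible \<T> S T then if compatible \<T> ori S T then 1 else -1 else 0)"

context oriented_complex
begin

lemma card_edges_of_triangle:
  assumes "S \<in> simplices \<T> 2"
  shows "card {E \<in> simplices \<T> 1. vertices E \<subseteq> vertices S} = 3"
proof -
  have S: "S \<in> \<T>" "card (vertices S) = 3"
    using assms by (auto simp: in_simplices_iff)
  have "inj_on vertices {E \<in> simplices \<T> 1. vertices E \<subseteq> vertices S}"
    by (intro inj_onI) (auto simp: in_simplices_iff vertices_inject)
  moreover have "vertices ` {E \<in> simplices \<T> 1. vertices E \<subseteq> vertices S}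
      = {W. W \<subseteq> vertices S \<and> card W = 2}"
  proof (intro equalityI subsetI)
    fix W assume W: "W \<in> {W. W \<subseteq> vertices S \<and> card W = 2}"
    then obtain E where "E \<in> \<T>" "vertices E = W"
      using subset_vertices_face[OF S(1), of W] by blast
    then show "W \<in> vertices ` {E \<in> simplices \<T> 1. vertices E \<subseteq> vertices S}"
      using W by (auto simp: in_simplices_iff intro!: image_eqI[of _ _ E])
  qed (auto simp: in_simplices_iff)
  ultimately have "card {E \<in> simplices \<T> 1. vertices E \<subseteq> vertices S}
      = card {W. W \<subseteq> vertices S \<and> card W = 2}"
    by (metis (no_types, lifting) card_image)
  also have "\<dots> = 3 choose 2"
    using n_subsets[OF simplex_vertices(3)[OF S(1)]] S(2) by simp
  finally show ?thesis
    by (simp add: eval_nat_numeral)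
qed

lemma common_edge_iff:
  assumes "S \<in> \<T>" "T \<in> \<T>"
  shows "common_edge \<T> S T E \<longleftrightarrow> E \<in> simplices \<T> 1 \<and> vertices E \<subseteq> vertices S \<inter> vertices T"
  using assms by (auto simp: common_edge_def in_simplices_iff face_iff_vertices_subset)

text \<open>The number 5 counts the three edges of a triangle and the two tetrahedra containing it.
  For distinct triangles in one tetrahedron the two sums cancel because \<open>\<partial>\<partial> = 0\<close>.\<close>

lemma transition_laplacian:
  assumes card_cofaces: "\<And>S. S \<in> simplices \<T> 2 \<Longrightarrow> card {R \<in> simplices \<T> 3. S face_of R} = 2"
    and S: "S \<in> simplices \<T> 2" and T: "T \<in> simplices \<T> 2"
  shows "transition \<T> ori S T = (if S = T then 5 else 0)
     - of_int (\<Sum>E\<in>simplices \<T> 1. incidence ori S E * incidence ori T E)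
     - of_int (\<Sum>R\<in>simplices \<T> 3. incidence ori R S * incidence ori R T)"
proof -
  have inc1: "vertices E \<subseteq> vertices S \<Longrightarrow> incidence ori S E = 1 \<or> incidence ori S E = -1"
    "\<not> vertices E \<subseteq> vertices S \<Longrightarrow> incidence ori S E = 0"
    if "S \<in> simplices \<T> 2" "E \<in> simplices \<T> 1" for S E
    using incidence_values[of S 1 E] that by (simp_all add: numeral_2_eq_2)
  have inc2: "vertices S \<subseteq> vertices R \<Longrightarrow> incidence ori R S = 1 \<or> incidence ori R S = -1"
    "\<not> vertices S \<subseteq> vertices R \<Longrightarrow> incidence ori R S = 0"
    if "R \<in> simplices \<T> 3" "S \<in> simplices \<T> 2" for R S
    using incidence_values[of R 2 S] that by (simp_all add: numeral_3_eq_3 numeral_2_eq_2)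
  have ST: "S \<in> \<T>" "T \<in> \<T>" and card: "card (vertices S) = 3" "card (vertices T) = 3"
    using S T by (auto simp: in_simplices_iff)
  note fin = simplex_vertices(3)[OF ST(1)] simplex_vertices(3)[OF ST(2)]
  have face: "S face_of R \<longleftrightarrow> vertices S \<subseteq> vertices R" if "R \<in> simplices \<T> 3" "S \<in> \<T>" for R S
    using that face_iff_vertices_subset simplices_in_complex by blast
  show ?thesis
  proof (cases "S = T")
    case True
    have "(\<Sum>E\<in>simplices \<T> 1. incidence ori S E * incidence ori S E)
        = (\<Sum>E\<in>simplices \<T> 1. if vertices E \<subseteq> vertices S then 1 else 0)"
      using incidence_square[of S 1] S by (intro sum.cong) (auto simp: numeral_2_eq_2)
    also have "\<dots> = 3"
      using card_edges_of_triangle[OF S] finite_simplices by (simp add: sum.If_cases Int_def)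
    finally have 1: "(\<Sum>E\<in>simplices \<T> 1. incidence ori S E * incidence ori S E) = 3" .
    have "(\<Sum>R\<in>simplices \<T> 3. incidence ori R S * incidence ori R S)
        = (\<Sum>R\<in>simplices \<T> 3. if S face_of R then 1 else 0)"
      using incidence_square[of _ 2 S] S face[OF _ ST(1)]
      by (intro sum.cong) (auto simp: numeral_3_eq_3 numeral_2_eq_2)
    also have "\<dots> = 2"
      using card_cofaces[OF S] finite_simplices by (simp add: sum.If_cases Int_def)
    finally have 2: "(\<Sum>R\<in>simplices \<T> 3. incidence ori R S * incidence ori R S) = 2" .
    have "{R \<in> simplices \<T> 3. S face_of R} \<noteq> {}"
      using card_cofaces[OF S] by (metis card.empty zero_neq_numeral)
    then have "\<not> admissible \<T> S S"
      by (auto simp: admissible_def)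
    then show ?thesis
      unfolding True[symmetric] 1 2 by (simp add: transition_def)
  next
    case False
    then have "vertices S \<noteq> vertices T"
      using vertices_inject ST by simp
    then have "card (vertices S \<inter> vertices T) \<noteq> 3"
      using card fin card_subset_eq[of "vertices S" "vertices S \<inter> vertices T"]
        card_subset_eq[of "vertices T" "vertices S \<inter> vertices T"] by auto
    moreover have "card (vertices S \<inter> vertices T) \<le> 3"
      using card fin card_mono[of "vertices S" "vertices S \<inter> vertices T"] by auto
    ultimately have meet: "card (vertices S \<inter> vertices T) \<le> 2"
      by simp
    \<comment> \<open>Two distinct triangles thus have two common vertices exactly when together
      they have four, as many as a tetrahedron has.\<close>
    have join: "card (vertices S \<union> vertices T) + card (vertices S \<inter> vertices T) = 6"
      using card_Un_Int[OF fin] card by simp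
    show ?thesis
    proof (cases "\<exists>E. common_edge \<T> S T E")
      case True
      then obtain E where E: "common_edge \<T> S T E" by blast
      have E1: "E \<in> simplices \<T> 1" and sub: "vertices E \<subseteq> vertices S \<inter> vertices T"
        using E ST by (auto simp: common_edge_iff)
      have vE: "vertices E' = vertices S \<inter> vertices T" if "common_edge \<T> S T E'" for E'
        using that ST meet fin
        by (intro card_seteq) (auto simp: common_edge_iff in_simplices_iff)
      have E_unique: "E' = E" if "common_edge \<T> S T E'" for E'
        using that E vE vertices_inject by (metis common_edge_def simplices_in_complex)
      have edges: "(\<Sum>E\<in>simplices \<T> 1. incidence ori S E * incidence ori T E)
          = incidence ori S E * incidence ori T E"
      proof -
        have "incidence ori S E' * incidence ori T E' = 0" if "E' \<in> simplices \<T> 1 - {E}" for E'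
        proof -
          have "\<not> common_edge \<T> S T E'"
            using E_unique that by blast
          then have "\<not> vertices E' \<subseteq> vertices S \<or> \<not> vertices E' \<subseteq> vertices T"
            using that ST by (auto simp: common_edge_iff)
          then show ?thesis
            using inc1[OF S, of E'] inc1[OF T, of E'] that by auto
        qed
        then have "(\<Sum>E\<in>simplices \<T> 1. incidence ori S E * incidence ori T E)
            = (\<Sum>E\<in>{E}. incidence ori S E * incidence ori T E)"
          by (intro sum.mono_neutral_right) (use E1 finite_simplices in auto)
        then show ?thesis by simp
      qed
      have units: "incidence ori S E = 1 \<or> incidence ori S E = -1"
        "incidence ori T E = 1 \<or> incidence ori T E = -1"
        using inc1[OF S E1] inc1[OF T E1] sub by auto
      \<comment> \<open>The union already exhausts the vertices of any tetrahedron containing both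
        triangles, so there is at most one such tetrahedron.\<close>
      have "card (vertices S \<union> vertices T) = 4"
        using join vE[OF E] E1 by (simp add: in_simplices_iff)
      then have coface: "vertices R = vertices S \<union> vertices T"
        if "R \<in> simplices \<T> 3" "vertices S \<subseteq> vertices R" "vertices T \<subseteq> vertices R" for R
        using that simplex_vertices(3)[of R]
        by (intro card_seteq[symmetric]) (auto simp: in_simplices_iff)
      show ?thesis
      proof (cases "\<exists>R\<in>simplices \<T> 3. S face_of R \<and> T face_of R")
        case True
        then obtain R where R: "R \<in> simplices \<T> 3" "vertices S \<subseteq> vertices R" "vertices T \<subseteq> vertices R"
          using face ST by blast
        have "incidence ori R' S * incidence ori R' T = 0" if "R' \<in> simplices \<T> 3 - {R}" for R'
        proof -
          have "\<not> vertices S \<subseteq> vertices R' \<or> \<not> vertices T \<subseteq> vertices R'"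
            using coface[of R'] coface[OF R] that vertices_inject[of R' R] R(1)
              simplices_in_complex[of R 3] simplices_in_complex[of R' 3] by auto
          then show ?thesis
            using inc2[OF _ S, of R'] inc2[OF _ T, of R'] that by auto
        qed
        then have "(\<Sum>R\<in>simplices \<T> 3. incidence ori R S * incidence ori R T)
            = (\<Sum>R\<in>{R}. incidence ori R S * incidence ori R T)"
          by (intro sum.mono_neutral_right) (use R finite_simplices in auto)
        moreover have "incidence ori R S = 1 \<or> incidence ori R S = -1"
          "incidence ori R T = 1 \<or> incidence ori R T = -1"
          using inc2[OF R(1) S] inc2[OF R(1) T] R by auto
        \<comment> \<open>All four numbers are 1 or -1, so this relation says that the products over
          \<open>R\<close> and over \<open>E\<close> are opposite: the edge term and the tetrahedron
          term cancel.\<close>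
        moreover have "incidence ori R S * incidence ori S E + incidence ori R T * incidence ori T E = 0"
        proof -
          obtain a where a: "a \<notin> vertices E" "vertices S = insert a (vertices E)"
            using facet_vertex[of S 1 E] S E1 sub by (auto simp: numeral_2_eq_2)
          obtain b where b: "b \<notin> vertices E" "vertices T = insert b (vertices E)"
            using facet_vertex[of T 1 E] T E1 sub by (auto simp: numeral_2_eq_2)
          show ?thesis
            using a b ST R(1) E1 coface[OF R] \<open>vertices S \<noteq> vertices T\<close>
            by (intro incidence_square_zero[of _ _ _ _ a b]) (auto simp: simplices_in_complex)
        qed
        moreover have "\<not> admissible \<T> S T"
          using True by (auto simp: admissible_def)
        ultimately show ?thesis
          using False edges units by (auto simp: transition_def)
      next
        case no_coface: False
        have "incidence ori R S * incidence ori R T = 0" if "R \<in> simplices \<T> 3" for R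
          using inc2[OF that S] inc2[OF that T] no_coface that face ST by auto
        then have "(\<Sum>R\<in>simplices \<T> 3. incidence ori R S * incidence ori R T) = 0"
          by (intro sum.neutral) blast
        moreover have "admissible \<T> S T"
          using no_coface E S T by (auto simp: admissible_def)
        moreover have "compatible \<T> ori S T \<longleftrightarrow> incidence ori S E = - incidence ori T E"
          unfolding compatible_def using E E_unique by metis
        ultimately show ?thesis
          using False edges units by (auto simp: transition_def)
      qed
    next
      case no_edge: False
      have "incidence ori S E * incidence ori T E = 0" if "E \<in> simplices \<T> 1" for E
        using inc1[OF S that] inc1[OF T that] no_edge that ST by (auto simp: common_edge_iff split: if_splits)
      then have "(\<Sum>E\<in>simplices \<T> 1. incidence ori S E * incidence ori T E) = 0"
        by (intro sum.neutral) blast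
      \<comment> \<open>Two distinct triangles of one tetrahedron have two common vertices by
        counting, and these span a common edge.\<close>
      moreover have "incidence ori R S * incidence ori R T = 0" if R: "R \<in> simplices \<T> 3" for R
      proof (rule ccontr)
        assume "incidence ori R S * incidence ori R T \<noteq> 0"
        then have "vertices S \<union> vertices T \<subseteq> vertices R"
          using inc2[OF R S] inc2[OF R T] by (auto split: if_splits)
        then have "card (vertices S \<union> vertices T) \<le> 4"
          using card_mono[of "vertices R" "vertices S \<union> vertices T"] simplex_vertices(3)[of R] R
          by (simp add: in_simplices_iff)
        then have "card (vertices S \<inter> vertices T) = 2"
          using meet join by simp
        moreover obtain E where "E \<in> \<T>" "vertices E = vertices S \<inter> vertices T"
          by (rule subset_vertices_face[OF ST(1), of "vertices S \<inter> vertices T"]) auto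
        ultimately have "common_edge \<T> S T E"
          using ST by (simp add: common_edge_iff in_simplices_iff)
        then show False
          using no_edge by blast
      qed
      then have "(\<Sum>R\<in>simplices \<T> 3. incidence ori R S * incidence ori R T) = 0"
        by (intro sum.neutral) blast
      moreover have "\<not> admissible \<T> S T"
        using no_edge by (auto simp: admissible_def)
      ultimately show ?thesis
        using False by (simp add: transition_def)
    qed
  qed
qed

end

section \<open>The dual decomposition\<close>

context oriented_complex
begin

text \<open>A flag can occur only in the dual cell of its first member, so at most one summand of
  \<open>star\<close> survives.\<close>

lemma star_eq:
  "star \<T> ori \<mu> c G =
     (if G \<in> flags \<T> \<and> last G \<in> simplices \<T> 3 \<and> card (vertices (hd G)) + length G = 5
      then c (hd G) * of_int (\<mu> (last G) * orientation_sign (ori (hd G) @ added_vertices G) (ori (last G)))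
      else 0)"
proof (cases "G \<in> flags \<T>")
  case True
  then have "hd G \<in> \<T>"
    by (cases G) (auto simp: flags_def)
  moreover have "star \<T> ori \<mu> c G = (\<Sum>S\<in>{hd G} \<inter> \<T>. c S * dual_cell \<T> ori \<mu> S G)"
    unfolding star_def
    by (rule sum.mono_neutral_right[OF finite_complex]) (auto simp: dual_cell_def)
  ultimately show ?thesis
    using True by (simp add: dual_cell_def)
qed (simp add: star_def dual_cell_def)

text \<open>Flags are ordered by inclusion of point sets. In a simplicial complex this is the face
  relation, because \<open>F \<inter> S\<close> is a face of \<open>S\<close>.\<close>

lemma vertices_psubset_iff:
  assumes "S \<in> \<T>" "F \<in> \<T>"
  shows "F \<subset> S \<longleftrightarrow> vertices F \<subset> vertices S"
proof -
  have "F \<subseteq> S \<longleftrightarrow> F face_of S"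
  proof
    assume "F \<subseteq> S"
    moreover have "(F \<inter> S) face_of S"
      using assms complex by (metis Int_commute simplicial_complex_def)
    ultimately show "F face_of S"
      by (simp add: Int_absorb2)
  qed (rule face_of_imp_subset)
  then show ?thesis
    using face_iff_vertices_subset[OF assms] vertices_inject[OF assms(2,1)] by auto
qed

lemma nonempty_simplex: "S \<in> simplices \<T> k \<Longrightarrow> S \<noteq> {}"
  by (auto simp: in_simplices_iff vertices_def extreme_point_of_def)

text \<open>The sign of the flag \<open>[F, R]\<close> in the dual edge of \<open>F\<close>, that
  is, of the part of this edge inside \<open>R\<close>. The constant chain 1 reads it off from
  \<open>star\<close>.\<close>

definition dual_sign :: "('a set \<Rightarrow> int) \<Rightarrow> 'a set \<Rightarrow> 'a set \<Rightarrow> complex" where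
  "dual_sign \<mu> F R = star \<T> ori \<mu> (\<lambda>S. 1) [F, R]"

context
  fixes F R :: "'a set" and r :: 'a
  assumes F: "F \<in> simplices \<T> 2" and R: "R \<in> simplices \<T> 3"
    and r: "r \<notin> vertices F" "vertices R = insert r (vertices F)"
begin

lemma flag_FR: "[F, R] \<in> flags \<T>"
  using F R r nonempty_simplex vertices_psubset_iff[of R F]
  by (auto simp: flags_def in_simplices_iff)

lemma dual_sign_eq: "dual_sign \<mu> F R = of_int (\<mu> R * orientation_sign (ori F @ [r]) (ori R))"
proof -
  have "vertices R - vertices F = {r}"
    using r by auto
  then have "added_vertices [F, R] = [r]"
    by (simp add: added_vertices_def)
  moreover have "card (vertices F) = 3"
    using F by (simp add: in_simplices_iff)
  ultimately show ?thesis
    using flag_FR R by (simp add: dual_sign_def star_eq)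
qed

lemma star_FR: "star \<T> ori \<mu> c [F, R] = c F * dual_sign \<mu> F R"
  unfolding dual_sign_def by (simp add: star_eq)

text \<open>The sign of the ordering \<open>ori E @ [v, r]\<close> factors through
  \<open>ori F @ [r]\<close>. The first factor is the incidence of \<open>F\<close> and
  \<open>E\<close>, with no extra sign since an edge has an even number of vertices; the second
  gives \<open>dual_sign\<close>.\<close>

lemma star_edge_flag:
  assumes E: "E \<in> simplices \<T> 1" and EF: "vertices E \<subseteq> vertices F"
  shows "[E, F, R] \<in> flags \<T>"
    "star \<T> ori \<mu> w [E, F, R] = of_int (incidence ori F E) * w E * dual_sign \<mu> F R"
proof -
  obtain v where v: "v \<notin> vertices E" "vertices F = insert v (vertices E)"
    using facet_vertex[of F 1 E] F E EF by (auto simp: numeral_2_eq_2)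
  note T = simplices_in_complex[OF E] simplices_in_complex[OF F] simplices_in_complex[OF R]
  have cE: "card (vertices E) = 2"
    using E by (simp add: in_simplices_iff)
  have "E \<subset> F" "F \<subset> R"
    using vertices_psubset_iff T v r by auto
  then show flag: "[E, F, R] \<in> flags \<T>"
    using nonempty_simplex[OF E] nonempty_simplex[OF F] nonempty_simplex[OF R] T by (auto simp: flags_def)
  have "vertices F - vertices E = {v}" "vertices R - vertices F = {r}"
    using v r by auto
  then have av: "added_vertices [E, F, R] = [v, r]"
    by (simp add: added_vertices_def)
  have oE: "distinct (ori E)" "set (ori E) = vertices E"
    using ori[OF T(1)] by auto
  have "orientation_sign (ori E @ [v, r]) (ori R)
      = orientation_sign (ori E @ [v, r]) (ori F @ [r]) * orientation_sign (ori F @ [r]) (ori R)"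
  proof (rule orientation_sign_trans[symmetric])
    have "mset (ori E @ [v]) = mset (ori F)"
      using v oE by (intro mset_ori_eqI[OF T(2)]) auto
    then show "mset (ori E @ [v, r]) = mset (ori F @ [r])"
      by simp
  qed (use oE v r in auto)
  also have "orientation_sign (ori E @ [v, r]) (ori F @ [r]) = orientation_sign (ori E @ [v]) (ori F)"
    using orientation_sign_snoc[of "ori E @ [v]" r "ori F"] oE v r by auto
  also have "\<dots> = incidence ori F E"
    using incidence_facet[OF T(2,1) v] cE by simp
  finally have "orientation_sign (ori E @ [v, r]) (ori R)
      = incidence ori F E * orientation_sign (ori F @ [r]) (ori R)" .
  then show "star \<T> ori \<mu> w [E, F, R] = of_int (incidence ori F E) * w E * dual_sign \<mu> F R"
    using flag R cE by (simp add: star_eq av dual_sign_eq)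
qed

text \<open>Up to \<open>dual_sign\<close>, the dual boundary is the coboundary: the flags of dual
  2-cells that have \<open>[F, R]\<close> as a face are the \<open>[E, F, R]\<close> with
  \<open>E\<close> an edge of \<open>F\<close>.\<close>

lemma sd_boundary_star:
  assumes w: "w \<in> chains \<T> 1"
  shows "sd_boundary \<T> (star \<T> ori \<mu> w) [F, R]
      = (\<Sum>E\<in>simplices \<T> 1. of_int (incidence ori F E) * w E) * dual_sign \<mu> F R"
proof -
  let ?J = "{E \<in> simplices \<T> 1. vertices E \<subseteq> vertices F}"
  let ?s = "\<lambda>G. \<Sum>i<length G. if take i G @ drop (Suc i) G = [F, R] then (-1) ^ i else 0 :: complex"
  have finite_flags: "finite (flags \<T>)"
  proof (rule finite_subset)
    show "flags \<T> \<subseteq> {G. set G \<subseteq> \<T> \<and> distinct G}"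
      by (auto simp: flags_def strict_sorted_iff distinct_conv_nth sorted_wrt_iff_nth_less) (metis linorder_neqE_nat psubset_eq)
    show "finite {G. set G \<subseteq> \<T> \<and> distinct G}"
      using finite_complex by (rule finite_subset_distinct)
  qed
  have noE: "E \<noteq> F" if "E \<in> simplices \<T> 1" for E
    using that F by (auto simp: in_simplices_iff)
  \<comment> \<open>Only deleting the entry at index 0 gives \<open>[F, R]\<close>; the other two
    faces begin with \<open>E\<close>, which differs from \<open>F\<close>.\<close>
  have coeff: "?s [E, F, R] = 1" if "E \<in> ?J" for E
    using noE[of E] that by (simp add: lessThan_Suc numeral_3_eq_3)
  have "sd_boundary \<T> (star \<T> ori \<mu> w) [F, R] = (\<Sum>G\<in>flags \<T>. star \<T> ori \<mu> w G * ?s G)"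
    using flag_FR by (simp add: sd_boundary_def)
  also have "\<dots> = (\<Sum>G\<in>(\<lambda>E. [E, F, R]) ` ?J. star \<T> ori \<mu> w G * ?s G)"
  proof (rule sum.mono_neutral_right[OF finite_flags])
    show "(\<lambda>E. [E, F, R]) ` ?J \<subseteq> flags \<T>"
      using star_edge_flag(1) by auto
    show "\<forall>G\<in>flags \<T> - (\<lambda>E. [E, F, R]) ` ?J. star \<T> ori \<mu> w G * ?s G = 0"
    proof (rule ballI, rule ccontr)
      fix G assume G: "G \<in> flags \<T> - (\<lambda>E. [E, F, R]) ` ?J" and "star \<T> ori \<mu> w G * ?s G \<noteq> 0"
      then have star: "star \<T> ori \<mu> w G \<noteq> 0" and s: "?s G \<noteq> 0"
        by auto
      have E: "hd G \<in> simplices \<T> 1"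
        using star w by (auto simp: star_eq chains_def split: if_splits)
      have "length G = 3"
        using star E by (auto simp: star_eq in_simplices_iff split: if_splits)
      then obtain E P Q where EPQ: "G = [E, P, Q]"
        by (auto simp: numeral_3_eq_3 length_Suc_conv)
      have EF: "E \<noteq> F"
        using noE E EPQ by auto
      have "P = F \<and> Q = R"
      proof (rule ccontr)
        assume "\<not> (P = F \<and> Q = R)"
        then have "?s G = 0"
          using EF by (simp add: EPQ lessThan_Suc numeral_3_eq_3)
        then show False using s by simp
      qed
      moreover have "vertices E \<subseteq> vertices F"
        using G calculation vertices_psubset_iff[of F E] by (auto simp: EPQ flags_def)
      ultimately show False
        using G E EPQ by auto
    qed
  qed
  also have "\<dots> = (\<Sum>E\<in>?J. star \<T> ori \<mu> w [E, F, R] * ?s [E, F, R])"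
    by (subst sum.reindex) (auto simp: inj_on_def)
  also have "\<dots> = (\<Sum>E\<in>?J. of_int (incidence ori F E) * w E * dual_sign \<mu> F R)"
    using coeff star_edge_flag(2) by (intro sum.cong) auto
  also have "\<dots> = (\<Sum>E\<in>simplices \<T> 1. of_int (incidence ori F E) * w E * dual_sign \<mu> F R)"
  proof (rule sum.mono_neutral_left[OF finite_simplices])
    show "\<forall>E\<in>simplices \<T> 1 - ?J. of_int (incidence ori F E) * w E * dual_sign \<mu> F R = 0"
      using incidence_nonzero_subset[of F 1] F by (auto simp: numeral_2_eq_2)
  qed auto
  finally show ?thesis
    by (simp add: sum_distrib_right)
qed

lemma dual_sign_nonzero:
  assumes "\<mu> R \<in> {1, -1}"
  shows "dual_sign \<mu> F R \<noteq> 0"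
proof -
  note T = simplices_in_complex[OF F] simplices_in_complex[OF R]
  have d: "distinct (ori F @ [r])"
    using ori[OF T(1)] r by simp
  moreover have "mset (ori F @ [r]) = mset (ori R)"
    using d ori[OF T(1)] r by (intro mset_ori_eqI[OF T(2)]) auto
  ultimately have "orientation_sign (ori F @ [r]) (ori R) = 1 \<or> orientation_sign (ori F @ [r]) (ori R) = -1"
    by (rule orientation_sign_values)
  then show ?thesis
    using assms by (auto simp: dual_sign_eq)
qed

end

section \<open>Recovering coefficients from dual chains\<close>

context
  fixes \<mu> :: "'a set \<Rightarrow> int"
  assumes \<mu>: "\<And>R. R \<in> simplices \<T> 3 \<Longrightarrow> \<mu> R \<in> {1, -1}"
    and coface: "\<And>F. F \<in> simplices \<T> 2 \<Longrightarrow> \<exists>R\<in>simplices \<T> 3. F face_of R"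
begin

lemma coface_obtain:
  assumes "F \<in> simplices \<T> 2"
  obtains R r where "R \<in> simplices \<T> 3" "r \<notin> vertices F" "vertices R = insert r (vertices F)"
proof -
  obtain R where R: "R \<in> simplices \<T> 3" "F face_of R"
    using coface[OF assms] by blast
  then have "vertices F \<subseteq> vertices R"
    using face_iff_vertices_subset simplices_in_complex assms by blast
  then obtain r where "r \<notin> vertices F" "vertices R = insert r (vertices F)"
    using facet_vertex[of R 2 F] R(1) assms by (auto simp: numeral_3_eq_3 numeral_2_eq_2)
  then show ?thesis
    using that R(1) by blast
qed

text \<open>The value of \<open>star\<close> at \<open>[S, R]\<close>, for any tetrahedron
  \<open>R\<close> over \<open>S\<close>, is the coefficient of \<open>S\<close> up to a nonzero
  sign.\<close>

lemma star_inj_on: "inj_on (star \<T> ori \<mu>) (chains \<T> 2)"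
proof (rule inj_onI, rule ext)
  fix c c' S assume c: "c \<in> chains \<T> 2" "c' \<in> chains \<T> 2" and eq: "star \<T> ori \<mu> c = star \<T> ori \<mu> c'"
  show "c S = c' S"
  proof (cases "S \<in> simplices \<T> 2")
    case True
    obtain R r where R: "R \<in> simplices \<T> 3" "r \<notin> vertices S" "vertices R = insert r (vertices S)"
      using coface_obtain[OF True] .
    have "c S * dual_sign \<mu> S R = c' S * dual_sign \<mu> S R"
      using eq star_FR[OF True R] by metis
    then show ?thesis
      using dual_sign_nonzero[where \<mu> = \<mu>, OF True R \<mu>[OF R(1)]] by simp
  qed (use c in \<open>auto simp: chains_def\<close>)
qed

text \<open>Injectivity makes \<open>inv_into\<close> a true inverse here, and the sign in
  \<open>dual_star\<close> is \<open>(-1) ^ 2\<close>.\<close>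

lemma dual_star_star:
  assumes "c \<in> chains \<T> 2"
  shows "dual_star \<T> ori \<mu> 1 (star \<T> ori \<mu> c) = c"
  using inv_into_f_f[OF star_inj_on assms] by (simp add: dual_star_def numeral_2_eq_2)

text \<open>Comparing both chains on the flags \<open>[F, R]\<close> turns a bounding relation
  between dual chains into a coboundary relation between the chains \<open>w\<close> and
  \<open>v\<close>.\<close>

lemma sd_boundary_starD:
  assumes "w \<in> chains \<T> 1" "sd_boundary \<T> (star \<T> ori \<mu> w) = (\<lambda>G. a * star \<T> ori \<mu> v G)"
    and F: "F \<in> simplices \<T> 2"
  shows "a * v F = (\<Sum>E\<in>simplices \<T> 1. of_int (incidence ori F E) * w E)"
proof -
  obtain R r where R: "R \<in> simplices \<T> 3" "r \<notin> vertices F" "vertices R = insert r (vertices F)"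
    using coface_obtain[OF F] .
  have "a * (v F * dual_sign \<mu> F R)
      = (\<Sum>E\<in>simplices \<T> 1. of_int (incidence ori F E) * w E) * dual_sign \<mu> F R"
    using sd_boundary_star[OF F R assms(1), of \<mu>] unfolding assms(2) star_FR[OF F R] .
  then show ?thesis
    using dual_sign_nonzero[where \<mu> = \<mu>, OF F R \<mu>[OF R(1)]] by (simp flip: mult.assoc)
qed

end

end

section \<open>The Poincare series\<close>

text \<open>Lists that are not geodesic get weight 0, so sums over geodesic paths extend to all
  nonempty lists of triangles, where they are governed by matrix powers.\<close>

lemma path_weight_transition:
  assumes "c \<noteq> []" "set c \<subseteq> simplices \<T> 2"
  shows "path_weight (transition \<T> ori) c = (if geodesic_path \<T> c then reversing_index \<T> ori c else 0)"
  using assms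
proof (induction c rule: induct_list012)
  case (2 S)
  then show ?case
    by (simp add: geodesic_path_def reversing_index_def)
next
  case (3 S T c)
  let ?n = "\<lambda>c. {i. Suc i < length c \<and> \<not> compatible \<T> ori (c ! i) (c ! Suc i)}"
  have n: "?n (S # T # c) = (if compatible \<T> ori S T then {} else {0}) \<union> Suc ` ?n (T # c)"
  proof (rule set_eqI)
    fix i
    show "i \<in> ?n (S # T # c) \<longleftrightarrow> i \<in> (if compatible \<T> ori S T then {} else {0}) \<union> Suc ` ?n (T # c)"
      by (cases i) auto
  qed
  have "finite (?n (T # c))"
    by (rule finite_subset[of _ "{..<length (T # c)}"]) auto
  then have "card (?n (S # T # c)) = (if compatible \<T> ori S T then 0 else 1) + card (?n (T # c))"
    unfolding n by (subst card_Un_disjoint) (auto simp: card_image)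
  then have rev: "reversing_index \<T> ori (S # T # c)
      = (if compatible \<T> ori S T then 1 else -1) * reversing_index \<T> ori (T # c)"
    by (simp add: reversing_index_def)
  have geo: "geodesic_path \<T> (S # T # c) \<longleftrightarrow> admissible \<T> S T \<and> geodesic_path \<T> (T # c)"
    using 3(4) by (auto simp: geodesic_path_def)
  have "path_weight (transition \<T> ori) (T # c)
      = (if geodesic_path \<T> (T # c) then reversing_index \<T> ori (T # c) else 0)"
    using 3(4) by (intro 3(2)) auto
  then show ?case
    unfolding path_weight.simps rev geo by (simp add: transition_def)
qed simp

lemma norm_transition_le: "norm (transition \<T> ori S T) \<le> 1"
  by (simp add: transition_def)

context oriented_complex
begin

text \<open>Integer coefficients are real, so the conjugation in the scalar product disappears and
  the first factor of the incidence number is the coboundary of \<open>\<kappa>\<close>.\<close>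

lemma chain_inner_boundary_single:
  assumes S: "S \<in> simplices \<T> 2" and \<kappa>: "\<kappa> \<in> integral_chains \<T> 1"
  shows "chain_inner \<T> (boundary \<T> ori (single S)) \<kappa>
    = (\<Sum>E\<in>simplices \<T> 1. of_int (incidence ori S E) * \<kappa> E)"
proof -
  have b: "boundary \<T> ori (single S) E = of_int (incidence ori S E)" if "E \<in> simplices \<T> 1" for E
  proof -
    have "(\<Sum>S'\<in>\<T>. single S S' * of_int (incidence ori S' E))
        = (\<Sum>S'\<in>\<T>. if S' = S then of_int (incidence ori S E) else (0::complex))"
      by (intro sum.cong) (auto simp: single_def)
    then show ?thesis
      using S that nonempty_simplex[OF that] finite_complex
      by (simp add: boundary_def simplices_in_complex)
  qed
  have "chain_inner \<T> (boundary \<T> ori (single S)) \<kappa>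
      = (\<Sum>E\<in>simplices \<T> 1. boundary \<T> ori (single S) E * cnj (\<kappa> E))"
    unfolding chain_inner_def
    by (rule sum.mono_neutral_right[OF finite_complex])
      (use \<kappa> in \<open>auto simp: simplices_in_complex integral_chains_def chains_def\<close>)
  also have "\<dots> = (\<Sum>E\<in>simplices \<T> 1. of_int (incidence ori S E) * \<kappa> E)"
  proof (intro sum.cong refl)
    fix E assume E: "E \<in> simplices \<T> 1"
    have "\<kappa> E \<in> \<int>"
      using \<kappa> by (simp add: integral_chains_def)
    then show "boundary \<T> ori (single S) E * cnj (\<kappa> E) = of_int (incidence ori S E) * \<kappa> E"
      using b[OF E] by (auto elim: Ints_cases)
  qed
  finally show ?thesis .
qed

lemma chain_inner_integral:
  assumes c: "c \<in> chains \<T> k" and v: "\<And>S. v S \<in> \<int>"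
  shows "chain_inner \<T> c v = (\<Sum>S\<in>simplices \<T> k. c S * v S)"
proof -
  have cnj: "cnj (v S) = v S" for S
    using v[of S] by (auto simp: Ints_def)
  show ?thesis
    unfolding chain_inner_def cnj
    by (rule sum.mono_neutral_right[OF finite_complex])
      (use c in \<open>auto simp: simplices_in_complex chains_def\<close>)
qed

lemma boundary_chain:
  assumes "c \<in> chains \<T> 2" "E \<in> simplices \<T> 1"
  shows "boundary \<T> ori c E = (\<Sum>S\<in>simplices \<T> 2. of_int (incidence ori S E) * c S)"
proof -
  have "(\<Sum>S\<in>\<T>. c S * of_int (incidence ori S E)) = (\<Sum>S\<in>simplices \<T> 2. c S * of_int (incidence ori S E))"
    by (rule sum.mono_neutral_right[OF finite_complex])
      (use assms in \<open>auto simp: simplices_in_complex chains_def\<close>)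
  then show ?thesis
    using assms nonempty_simplex[OF assms(2)] by (simp add: boundary_def simplices_in_complex mult.commute)
qed

end

theorem theorem8:
  fixes M :: "'m topology"
    and \<T> :: "'a::euclidean_space set set"
    and h :: "'a \<Rightarrow> 'm"
    and ori :: "'a set \<Rightarrow> 'a list"
    and \<mu> :: "'a set \<Rightarrow> int"
    and \<kappa>1 :: "'a chain"
    and \<kappa>2 :: "'a sd_chain"
  assumes "closed_3_manifold M"
    and "triangulates \<T> h M"
    and "\<And>S. S \<in> simplices \<T> 2 \<Longrightarrow> card {R \<in> simplices \<T> 3. S face_of R} = 2"
    and "simplex_orientations \<T> ori"
    and "manifold_orientation \<T> ori \<mu>"
    and "knot \<T> ori \<kappa>1"
    and "rationally_null_homologous \<T> ori \<kappa>1"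
    and "dual_knot \<T> ori \<mu> \<kappa>2"
    and "dual_rationally_null_homologous \<T> ori \<mu> \<kappa>2"
  shows "\<exists>r>0. \<exists>p q :: complex poly.
      (\<forall>z. norm z < r \<longrightarrow>
         poincare_term \<T> ori \<mu> \<kappa>1 \<kappa>2 z summable_on orthogeodesics \<T> ori \<mu> \<kappa>1 \<kappa>2 \<and>
         poly q z \<noteq> 0 \<and>
         poincare_series \<T> ori \<mu> \<kappa>1 \<kappa>2 z = poly p z / poly q z) \<and>
      poly q (1/5) \<noteq> 0 \<and>
      poly p (1/5) / poly q (1/5) = of_rat (linking_number \<T> ori \<mu> \<kappa>1 \<kappa>2)"
proof -
  interpret oriented_complex \<T> ori
    using assms(2,4) by unfold_locales (auto simp: triangulates_def)
  let ?X = "simplices \<T> 2" and ?Y = "simplices \<T> 1" and ?Z = "simplices \<T> 3"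
  \<comment> \<open>The chain groups of degrees 3, 2 and 1, with
    \<open>t = n + 2 = 5\<close>.\<close>
  interpret path_operator ?X ?Y ?Z "incidence ori" "incidence ori" "transition \<T> ori" 5
  proof unfold_locales
    show "(\<Sum>x\<in>?X. incidence ori z x * incidence ori x y) = 0" if "z \<in> ?Z" "y \<in> ?Y" for z y
      using incidence_exact[of z 1 y] that by (simp add: numeral_2_eq_2 numeral_3_eq_3)
  qed (use finite_simplices transition_laplacian[OF assms(3)] in auto)
  have \<mu>: "\<mu> R \<in> {1, -1}" if "R \<in> ?Z" for R
    using assms(5) that by (simp add: manifold_orientation_def)
  have coface: "\<exists>R\<in>?Z. F face_of R" if "F \<in> ?X" for F
  proof -
    have "{R \<in> ?Z. F face_of R} \<noteq> {}"
      using assms(3)[OF that] by (metis card.empty zero_neq_numeral)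
    then show ?thesis by blast
  qed
  have \<kappa>1: "\<kappa>1 \<in> integral_chains \<T> 1"
    using assms(6) by (simp add: knot_def)
  obtain v where v: "v \<in> integral_chains \<T> 2" and \<kappa>2: "\<kappa>2 = star \<T> ori \<mu> v"
    using assms(8) by (auto simp: dual_knot_def integral_dual_chains_def numeral_2_eq_2)
  have v_chain: "v \<in> chains \<T> 2" and v_int: "v S \<in> \<int>" for S
    using v by (auto simp: integral_chains_def)
  have dual_\<kappa>2: "dual_star \<T> ori \<mu> 1 \<kappa>2 = v"
    unfolding \<kappa>2 by (rule dual_star_star[OF \<mu> coface v_chain])
  obtain n2 w where n2: "n2 > 0" and w: "w \<in> chains \<T> 1"
    and w_bd: "sd_boundary \<T> (star \<T> ori \<mu> w) = (\<lambda>F. of_nat n2 * star \<T> ori \<mu> v F)"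
    using assms(9) by (auto simp: dual_rationally_null_homologous_def integral_dual_chains_def
        integral_chains_def \<kappa>2)
  \<comment> \<open>A rational primitive of \<open>v\<close>: the dual chain of \<open>w\<close>
    bounds \<open>n2\<close> times \<open>\<kappa>2\<close>, so the coboundary of \<open>w'\<close>
    is \<open>v\<close>.\<close>
  define w' where "w' E = w E / of_nat n2" for E
  have v_cobd: "v x = cobd w' x" if "x \<in> ?X" for x
  proof -
    have "of_nat n2 * v x = (\<Sum>E\<in>?Y. of_int (incidence ori x E) * w E)"
      by (rule sd_boundary_starD[OF \<mu> coface w w_bd that])
    then have "v x = (\<Sum>E\<in>?Y. of_int (incidence ori x E) * w E) / of_nat n2"
      using n2 by (simp add: eq_divide_eq mult.commute)
    then show ?thesis
      unfolding cobd_def w'_def sum_divide_distrib by simp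
  qed
  \<comment> \<open>By adjointness the pairing of \<open>\<sigma>\<close> with
    \<open>v = cobd w'\<close> is \<open>n\<close> times that of \<open>\<kappa>1\<close> with
    \<open>w'\<close>. The last expression involves neither \<open>\<sigma>\<close> nor
    \<open>n\<close>, which gives the uniqueness required by the \<open>THE\<close> in
    \<open>linking_number\<close>.\<close>
  have pairing: "intersection_number \<T> ori \<mu> \<sigma> \<kappa>2 / of_nat n = (\<Sum>y\<in>?Y. \<kappa>1 y * w' y)"
    "intersection_number \<T> ori \<mu> \<sigma> \<kappa>2 = (\<Sum>x\<in>?X. \<sigma> x * v x)"
    if "n > 0" "\<sigma> \<in> integral_chains \<T> 2" "boundary \<T> ori \<sigma> = (\<lambda>S. of_nat n * \<kappa>1 S)" for \<sigma> n
  proof -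
    have \<sigma>: "\<sigma> \<in> chains \<T> 2"
      using that by (simp add: integral_chains_def)
    show inter: "intersection_number \<T> ori \<mu> \<sigma> \<kappa>2 = (\<Sum>x\<in>?X. \<sigma> x * v x)"
      unfolding intersection_number_def dual_\<kappa>2 by (rule chain_inner_integral[OF \<sigma> v_int])
    have "bd \<sigma> y = of_nat n * \<kappa>1 y" if "y \<in> ?Y" for y
      using boundary_chain[OF \<sigma> that] unfolding \<open>boundary \<T> ori \<sigma> = _\<close> bd_def by (rule sym)
    then have "(\<Sum>x\<in>?X. \<sigma> x * v x) = of_nat n * (\<Sum>y\<in>?Y. \<kappa>1 y * w' y)"
      using bd_cobd_adjoint[of \<sigma> w'] v_cobd by (simp add: sum_distrib_left mult.assoc)
    then show "intersection_number \<T> ori \<mu> \<sigma> \<kappa>2 / of_nat n = (\<Sum>y\<in>?Y. \<kappa>1 y * w' y)"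
      unfolding inter using \<open>n > 0\<close> by simp
  qed
  obtain n \<sigma> where n: "n > 0" and \<sigma>: "\<sigma> \<in> integral_chains \<T> 2"
    and \<sigma>_bd: "boundary \<T> ori \<sigma> = (\<lambda>S. of_nat n * \<kappa>1 S)"
    using assms(7) by (auto simp: rationally_null_homologous_def)
  \<comment> \<open>A rational 2-chain with boundary \<open>\<kappa>1\<close>.\<close>
  define s where "s x = \<sigma> x / of_nat n" for x
  have link: "of_rat (linking_number \<T> ori \<mu> \<kappa>1 \<kappa>2) = (\<Sum>x\<in>?X. s x * v x)"
  proof -
    \<comment> \<open>Integrality makes the quotient by \<open>n\<close> a rational number, as
      \<open>linking_number\<close> requires.\<close>
    have "(\<Sum>x\<in>?X. \<sigma> x * v x) \<in> \<int>"
      using \<sigma> v_int by (auto simp: integral_chains_def)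
    then obtain m where m: "(\<Sum>x\<in>?X. \<sigma> x * v x) = of_int m"
      by (auto elim: Ints_cases)
    define q0 :: rat where "q0 = of_int m / of_nat n"
    have q0: "of_rat q0 = intersection_number \<T> ori \<mu> \<sigma> \<kappa>2 / of_nat n"
      unfolding pairing(2)[OF n \<sigma> \<sigma>_bd] m q0_def by (simp add: of_rat_divide)
    have "linking_number \<T> ori \<mu> \<kappa>1 \<kappa>2 = q0"
      unfolding linking_number_def
    proof (rule the_equality)
      show "\<exists>p>0. \<exists>\<sigma>\<in>integral_chains \<T> 2. boundary \<T> ori \<sigma> = (\<lambda>S. of_nat p * \<kappa>1 S) \<and>
          of_rat q0 = intersection_number \<T> ori \<mu> \<sigma> \<kappa>2 / of_nat p"
        using n \<sigma> \<sigma>_bd q0 by blast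
    next
      fix q assume "\<exists>p>0. \<exists>\<sigma>\<in>integral_chains \<T> 2. boundary \<T> ori \<sigma> = (\<lambda>S. of_nat p * \<kappa>1 S) \<and>
          of_rat q = intersection_number \<T> ori \<mu> \<sigma> \<kappa>2 / of_nat p"
      then have "(of_rat q :: complex) = (\<Sum>y\<in>?Y. \<kappa>1 y * w' y)"
        using pairing(1) by auto
      then have "(of_rat q :: complex) = of_rat q0"
        unfolding q0 pairing(1)[OF n \<sigma> \<sigma>_bd] .
      then show "q = q0"
        by simp
    qed
    then show ?thesis
      using q0 pairing(2)[OF n \<sigma> \<sigma>_bd] by (simp add: s_def sum_divide_distrib)
  qed
  define u where "u x = cobd (bd s) x" for x
  have u: "chain_inner \<T> (boundary \<T> ori (single x)) \<kappa>1 = u x" if "x \<in> ?X" for x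
  proof -
    have \<kappa>1_bd: "\<kappa>1 y = bd s y" if "y \<in> ?Y" for y
    proof -
      have "of_nat n * \<kappa>1 y = (\<Sum>x\<in>?X. of_int (incidence ori x y) * \<sigma> x)"
        using boundary_chain[OF _ that, of \<sigma>] \<sigma> by (simp add: \<sigma>_bd integral_chains_def)
      then have "\<kappa>1 y = (\<Sum>x\<in>?X. of_int (incidence ori x y) * \<sigma> x) / of_nat n"
        using n by (simp add: eq_divide_eq mult.commute)
      then show ?thesis
        unfolding bd_def s_def sum_divide_distrib by simp
    qed
    show ?thesis
      unfolding chain_inner_boundary_single[OF that \<kappa>1] u_def cobd_def
      by (intro sum.cong) (simp_all add: \<kappa>1_bd)
  qed
  have last_factor: "chain_inner \<T> (single x) v = v x" if "x \<in> ?X" for x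
  proof -
    have "single x \<in> chains \<T> 2"
      using that by (auto simp: single_def chains_def)
    then have "chain_inner \<T> (single x) v = (\<Sum>S\<in>?X. single x S * v S)"
      by (rule chain_inner_integral[OF _ v_int])
    also have "\<dots> = (\<Sum>S\<in>?X. if S = x then v x else 0)"
      by (intro sum.cong) (auto simp: single_def)
    finally show ?thesis
      using that finite_simplices by simp
  qed
  obtain p q where q0: "poly q 0 \<noteq> 0" and q5: "poly q (1/5) \<noteq> 0"
    and at_fifth: "poly p (1/5) / poly q (1/5) = (\<Sum>x\<in>?X. s x * v x)"
    and solve: "\<forall>z G. (\<forall>x\<in>?X. G x - z * (\<Sum>x'\<in>?X. transition \<T> ori x x' * G x') = v x) \<longrightarrow>
       poly q z * (z * (\<Sum>x\<in>?X. cobd (bd s) x * G x)) = poly p z"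
    using resolvent_pairing[of v w' s, OF v_cobd] by blast
  have "q \<noteq> 0"
    using q0 by auto
  then obtain \<delta> where \<delta>: "\<delta> > 0" and avoid: "\<And>x. poly q x = 0 \<Longrightarrow> x \<noteq> 0 \<Longrightarrow> \<delta> \<le> dist 0 x"
    using finite_set_avoid[OF poly_roots_finite, of q 0] by auto
  \<comment> \<open>Below \<open>\<delta>\<close> there is no root of \<open>q\<close> other than
    possibly 0, which \<open>q0\<close> excludes; the second bound yields convergence, with
    \<open>Suc\<close> covering an empty \<open>?X\<close>.\<close>
  define r where "r = min \<delta> (1 / real (Suc (card ?X)))"
  have "poincare_term \<T> ori \<mu> \<kappa>1 \<kappa>2 z summable_on orthogeodesics \<T> ori \<mu> \<kappa>1 \<kappa>2 \<and>
      poly q z \<noteq> 0 \<and> poincare_series \<T> ori \<mu> \<kappa>1 \<kappa>2 z = poly p z / poly q z"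
    if small: "norm z < r" for z
  proof -
    have "norm z * card ?X \<le> norm z * real (Suc (card ?X))"
      by (intro mult_left_mono) auto
    also have "\<dots> < 1"
      using small by (simp add: r_def field_simps)
    finally interpret path_series ?X "transition \<T> ori" u v z
      by unfold_locales (auto simp: finite_simplices norm_transition_le)
    have qz: "poly q z \<noteq> 0"
      using avoid[of z] q0 small by (auto simp: r_def dist_norm)
    have "poly q z * (z * (\<Sum>x\<in>?X. u x * green x)) = poly p z"
      using solve green_equation unfolding u_def by blast
    then have sum_eq: "z * (\<Sum>x\<in>?X. u x * green x) = poly p z / poly q z"
      using qz by (simp add: field_simps)
    \<comment> \<open>Passing from orthogeodesics to all nonempty lists of triangles only adds zero
      terms: a list that is no orthogeodesic has path weight 0 or a vanishing factor at one
      end.\<close>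
    have "(poincare_term \<T> ori \<mu> \<kappa>1 \<kappa>2 z has_sum (poly p z / poly q z)) (orthogeodesics \<T> ori \<mu> \<kappa>1 \<kappa>2)
      \<longleftrightarrow> ((\<lambda>c. u (hd c) * (path_weight (transition \<T> ori) c * v (last c)) * z ^ length c)
        has_sum (poly p z / poly q z)) {c. c \<noteq> [] \<and> set c \<subseteq> ?X}"
    proof (rule has_sum_cong_neutral)
      have ends: "u (hd c) = chain_inner \<T> (boundary \<T> ori (single (hd c))) \<kappa>1"
        "v (last c) = chain_inner \<T> (single (last c)) v" if "c \<noteq> []" "set c \<subseteq> ?X" for c
        using that u[of "hd c"] last_factor[of "last c"] subsetD[OF that(2) hd_in_set[OF that(1)]]
          subsetD[OF that(2) last_in_set[OF that(1)]] by auto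
      have orth: "c \<in> orthogeodesics \<T> ori \<mu> \<kappa>1 \<kappa>2
          \<longleftrightarrow> geodesic_path \<T> c \<and> u (hd c) \<noteq> 0 \<and> v (last c) \<noteq> 0" if "c \<noteq> []" "set c \<subseteq> ?X" for c
        unfolding orthogeodesics_def dual_\<kappa>2 using ends[OF that] by simp
      show "poincare_term \<T> ori \<mu> \<kappa>1 \<kappa>2 z c = 0"
        if "c \<in> orthogeodesics \<T> ori \<mu> \<kappa>1 \<kappa>2 - {c. c \<noteq> [] \<and> set c \<subseteq> ?X}" for c
        using that by (auto simp: orthogeodesics_def geodesic_path_def)
      show "u (hd c) * (path_weight (transition \<T> ori) c * v (last c)) * z ^ length c = 0"
        if "c \<in> {c. c \<noteq> [] \<and> set c \<subseteq> ?X} - orthogeodesics \<T> ori \<mu> \<kappa>1 \<kappa>2" for c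
        using that orth[of c] path_weight_transition[of c \<T> ori] by auto
      show "poincare_term \<T> ori \<mu> \<kappa>1 \<kappa>2 z c
          = u (hd c) * (path_weight (transition \<T> ori) c * v (last c)) * z ^ length c"
        if "c \<in> orthogeodesics \<T> ori \<mu> \<kappa>1 \<kappa>2 \<inter> {c. c \<noteq> [] \<and> set c \<subseteq> ?X}" for c
        unfolding poincare_term_def incidence_number_def dual_\<kappa>2
        using that ends[of c] orth[of c] path_weight_transition[of c \<T> ori] by simp
    qed
    then have "(poincare_term \<T> ori \<mu> \<kappa>1 \<kappa>2 z has_sum (poly p z / poly q z)) (orthogeodesics \<T> ori \<mu> \<kappa>1 \<kappa>2)"
      using path_series_has_sum unfolding sum_eq by blast
    then show ?thesis
      using qz by (auto simp: poincare_series_def infsumI summable_on_def)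
  qed
  moreover have "r > 0"
    using \<delta> by (simp add: r_def)
  ultimately show ?thesis
    using q5 at_fifth link by (intro exI[of _ r] conjI exI[of _ p] exI[of _ q]) auto
qed

end
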